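(* Suppose $0\leqslant\alpha<n$, $1<r<p_1$, $1<s<p_2$ and $\frac{rs}{r+s}<p=\frac{p_1p_2}{p_1+p_2}\leqslant q$. For any set of weights \begin{align*} (u,v_1,v_2)\in \bigcup_{\substack{\phi_1\in\mathscr Y_{r,\,B_{p_1,\frac{p_1q}{p}}} \\ \phi_2\in\mathscr Y_{s,\,B_{p_2,\frac{p_2q}{p}}}}}\mathsf A^{[\phi_1,\,\phi_2],\,t^q}_{[p_1,\,p_2],\,q} \end{align*} we have \begin{align*} \|\mathcal{M}_\alpha^{r,s}(f,g)\|_{L^q(u)}\lesssim\|f\|_{L^{p_1}(v_1)}\,\|g\|_{L^{p_2}(v_2)}. \end{align*}
   Context: $\mathcal{M}_\alpha^{r,s}(f,g)(x)=\sup_{Q\ni x}|Q|^{\frac{\alpha}{n}}\left(\frac{1}{|Q|}\int_Q|f|^r\right)^{\frac1r}\left(\frac{1}{|Q|}\int_Q|g|^s\right)^{\frac1s}$, supremum over cubes containing $x$. Weights are non-negative locally integrable functions. A Young function is a convex, continuous, strictly increasing $\Phi:[0,\infty)\to[0,\infty)$ with $\Phi(0)=0$ and $\Phi(t)/t\to\infty$; $\|f\|_{\Phi,Q}=\inf\{\lambda>0:\frac{1}{|Q|}\int_Q\Phi(|f|/\lambda)\le1\}$. $\Phi\in B_{p,q}$ if $\int_c^\infty \Phi(t)^{q/p}t^{-q-1}dt<\infty$ for some $c>0$. $\mathsf A^{[\phi_1,\phi_2],\phi}_{[p_1,p_2],q}$ is the set of triples of weights $(u,v_1,v_2)$ with $\sup_Q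 |Q|^{\frac{\alpha}{n}+\frac1q-\frac1p}\|u^{1/q}\|_{\phi,Q}\|v_1^{-1/p_1}\|_{\phi_1,Q}\|v_2^{-1/p_2}\|_{\phi_2,Q}<\infty$; here $\phi(t)=t^q$, so the $u$-factor is $\left(\frac{1}{|Q|}\int_Q u\right)^{1/q}$. $\mathscr Y_{r,B_{p_1,\frac{p_1q}{p}}}$ is the set of Young functions $\phi_1$ such that $t^{1/r}/\phi_1^{-1}(t)$ is the inverse of a Young function in $B_{p_1,\frac{p_1q}{p}}$; similarly $\mathscr Y_{s,B_{p_2,\frac{p_2q}{p}}}$ with $t^{1/s}/\phi_2^{-1}(t)$ and $B_{p_2,\frac{p_2q}{p}}$. *)

theory Defs
  imports "HOL-Analysis.Analysis"
begin

text \<open>Power of an extended nonnegative real with positive real exponent; infinity stays infinity.\<close>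
definition enn_powr :: "ennreal \<Rightarrow> real \<Rightarrow> ennreal" where
  "enn_powr x a = (if x = \<infinity> then \<infinity> else ennreal (enn2real x powr a))"

definition is_cube :: "'a::euclidean_space set \<Rightarrow> bool" where
  "is_cube Q \<longleftrightarrow> (\<exists>a h. h > 0 \<and> Q = cbox a (a + h *\<^sub>R One))"

abbreviation vol :: "'a::euclidean_space set \<Rightarrow> real" where
  "vol Q \<equiv> measure lebesgue Q"

definition avg :: "'a::euclidean_space set \<Rightarrow> ('a \<Rightarrow> ennreal) \<Rightarrow> ennreal" where
  "avg Q F = ennreal (1 / vol Q) * (\<integral>\<^sup>+ x \<in> Q. F x \<partial>lebesgue)"

definition frac_max :: "real \<Rightarrow> real \<Rightarrow> real \<Rightarrow> ('a::euclidean_space \<Rightarrow> real) \<Rightarrow> ('a \<Rightarrow> real) \<Rightarrow> 'a \<Rightarrow> ennreal" where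
  "frac_max \<alpha> r s f g x =
     (SUP Q \<in> {Q. is_cube Q \<and> x \<in> Q}.
        ennreal (vol Q powr (\<alpha> / real DIM('a)))
        * enn_powr (avg Q (\<lambda>y. ennreal (\<bar>f y\<bar> powr r))) (1 / r)
        * enn_powr (avg Q (\<lambda>y. ennreal (\<bar>g y\<bar> powr s))) (1 / s))"

definition wnorm :: "('a::euclidean_space \<Rightarrow> real) \<Rightarrow> real \<Rightarrow> ('a \<Rightarrow> ennreal) \<Rightarrow> ennreal" where
  "wnorm w p F = enn_powr (\<integral>\<^sup>+ x. enn_powr (F x) p * ennreal (w x) \<partial>lebesgue) (1 / p)"

definition weight :: "('a::euclidean_space \<Rightarrow> real) \<Rightarrow> bool" where
  "weight w \<longleftrightarrow> w \<in> borel_measurable lebesgue \<and> (\<forall>x. 0 \<le> w x)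
     \<and> (\<forall>K. compact K \<longrightarrow> set_integrable lebesgue K w)"

definition young :: "(real \<Rightarrow> real) \<Rightarrow> bool" where
  "young \<Phi> \<longleftrightarrow> convex_on {0..} \<Phi> \<and> continuous_on {0..} \<Phi> \<and> strict_mono_on {0..} \<Phi>
     \<and> \<Phi> 0 = 0 \<and> filterlim (\<lambda>t. \<Phi> t / t) at_top at_top"

text \<open>Inverse of a Young function (a bijection of [0,oo)).\<close>
definition young_inv :: "(real \<Rightarrow> real) \<Rightarrow> real \<Rightarrow> real" where
  "young_inv \<Phi> = the_inv_into {0..} \<Phi>"

definition B_class :: "real \<Rightarrow> real \<Rightarrow> (real \<Rightarrow> real) set" where
  "B_class p q = {\<Phi>. \<exists>c>0. (\<integral>\<^sup>+ t \<in> {c..}. ennreal (\<Phi> t powr (q / p) * t powr (- q - 1)) \<partial>lborel) < \<infinity>}"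

definition Y_class :: "real \<Rightarrow> (real \<Rightarrow> real) set \<Rightarrow> (real \<Rightarrow> real) set" where
  "Y_class r B = {\<phi>. young \<phi> \<and> (\<exists>\<Psi>. young \<Psi> \<and> \<Psi> \<in> B \<and>
       (\<forall>t>0. young_inv \<Psi> t = t powr (1 / r) / young_inv \<phi> t))}"

definition young_ext :: "(real \<Rightarrow> real) \<Rightarrow> ennreal \<Rightarrow> ennreal" where
  "young_ext \<Phi> y = (if y = \<infinity> then \<infinity> else ennreal (\<Phi> (enn2real y)))"

text \<open>Luxemburg norm over a cube of an extended nonnegative function (oo if no lambda works).\<close>
definition lux :: "(real \<Rightarrow> real) \<Rightarrow> 'a::euclidean_space set \<Rightarrow> ('a \<Rightarrow> ennreal) \<Rightarrow> ennreal" where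
  "lux \<Phi> Q F = Inf {ennreal l | l. l > 0 \<and> avg Q (\<lambda>x. young_ext \<Phi> (F x / ennreal l)) \<le> 1}"

definition neg_root :: "('a \<Rightarrow> real) \<Rightarrow> real \<Rightarrow> 'a \<Rightarrow> ennreal" where
  "neg_root v p x = (if v x = 0 then \<infinity> else ennreal (v x powr (- 1 / p)))"

definition A_class :: "real \<Rightarrow> real \<Rightarrow> real \<Rightarrow> real \<Rightarrow> (real \<Rightarrow> real) \<Rightarrow> (real \<Rightarrow> real)
     \<Rightarrow> (('a::euclidean_space \<Rightarrow> real) \<times> ('a \<Rightarrow> real) \<times> ('a \<Rightarrow> real)) set" where
  "A_class \<alpha> p1 p2 q \<phi>1 \<phi>2 = {(u, v1, v2). weight u \<and> weight v1 \<and> weight v2 \<and>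
     (SUP Q \<in> {Q. is_cube Q}.
        ennreal (vol Q powr (\<alpha> / real DIM('a) + 1 / q - 1 / (p1 * p2 / (p1 + p2))))
        * enn_powr (avg Q (\<lambda>x. ennreal (u x))) (1 / q)
        * lux \<phi>1 Q (neg_root v1 p1)
        * lux \<phi>2 Q (neg_root v2 p2)) < \<infinity>}"

end

theory Submission
  imports Defs
begin

text \<open>
  Write \<open>F = \<bar>f\<bar> v\<^sub>1\<^bsup>1/p\<^sub>1\<^esup>\<close> and let \<open>\<Psi>\<^sub>1\<close> be the Young function in \<open>B\<close> with \<open>\<Psi>\<^sub>1\<^sup>-\<^sup>1 \<phi>\<^sub>1\<^sup>-\<^sup>1 = t\<^bsup>1/r\<^esup>\<close>.
  Generalised Hoelder bounds the \<open>r\<close>-mean of \<open>f\<close> over \<open>Q\<close> by \<open>\<mu>\<^sub>1(Q) \<parallel>v\<^sub>1\<^bsup>-1/p\<^sub>1\<^esup>\<parallel>\<^bsub>\<phi>\<^sub>1,Q\<^esub>\<close> with \<open>\<mu>\<^sub>1(Q)\<close>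
  comparable to \<open>\<parallel>F\<parallel>\<^bsub>\<Psi>\<^sub>1,Q\<^esub>\<close>, and likewise for \<open>g\<close>. By the weight condition the contribution of a cube
  \<open>Q\<close> to the integral is at most a constant times
  \<open>(\<bar>Q\<bar> \<mu>\<^sub>1\<^bsup>p\<^sub>1\<^esup>)\<^bsup>q/p\<^sub>1\<^esup> (\<bar>Q\<bar> \<mu>\<^sub>2\<^bsup>p\<^sub>2\<^esup>)\<^bsup>q/p\<^sub>2\<^esup>\<close>.
  The one-third trick replaces cubes by finitely many dyadic grids, and stopping cubes reduce the
  maximal function to a sparse family. Hoelder for sums with exponents \<open>p\<^sub>1/p\<close>, \<open>p\<^sub>2/p\<close> separates the factors, so
  it remains to see that \<open>\<Sum>\<^sub>Q (\<bar>Q\<bar> \<mu>\<^sub>1\<^bsup>p\<^sub>1\<^esup>)\<^bsup>q/p\<^esup>\<close> is bounded by \<open>(\<integral> F\<^bsup>p\<^sub>1\<^esup>)\<^bsup>q/p\<^esup>\<close>. A second stopping time makes \<open>\<mu>\<^sub>1\<close>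
  double along chains; since \<open>\<bar>Q\<bar> \<mu>\<^sub>1\<^bsup>p\<^sub>1\<^esup>\<close> is at most the integral of \<open>F\<^bsup>p\<^sub>1\<^esup> \<eta>(F/\<mu>\<^sub>1)\<close> over \<open>Q\<close>, where
  \<open>\<eta>(t) = \<Psi>\<^sub>1(t)/t\<^bsup>p\<^sub>1\<^esup>\<close> for large \<open>t\<close> and \<open>0\<close> otherwise, the sum is controlled pointwise by the sum of
  \<open>\<eta>\<^bsup>q/p\<^esup>\<close> over a lacunary sequence, which is the integral in the condition \<open>B\<close>.
\<close>

subsection \<open>Powers\<close>

lemma enn_powr_ennreal: "0 \<le> x \<Longrightarrow> enn_powr (ennreal x) a = ennreal (x powr a)"
  by (simp add: enn_powr_def)

lemma enn_powr_0: "enn_powr 0 a = 0"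
  by (simp add: enn_powr_def)

lemma enn_powr_1: "enn_powr x 1 = x"
  by (cases x) (auto simp: enn_powr_def)

lemma enn_powr_mono:
  assumes "x \<le> y" "0 \<le> a"
  shows "enn_powr x a \<le> enn_powr y a"
  using assms by (cases x; cases y) (auto simp: enn_powr_def powr_mono2 top_unique)

text \<open>\<open>enn_powr\<close> fixes both 0 and \<infinity> for every exponent, so it respects
  the convention 0 * \<infinity> = 0; the infinite cases reduce to this.\<close>

lemma enn_powr_mult: "enn_powr (x * y) a = enn_powr x a * enn_powr y a"
proof (cases x)
  case x: (real a')
  show ?thesis
  proof (cases y)
    case (real b')
    with x show ?thesis
      by (simp add: enn_powr_ennreal powr_mult flip: ennreal_mult)
  next
    case top
    with x show ?thesis
      by (cases "a' = 0") (auto simp: enn_powr_def ennreal_mult_top)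
  qed
next
  case top
  then show ?thesis
    by (cases y; cases "y = 0") (auto simp: enn_powr_def ennreal_top_mult)
qed

lemma enn_powr_powr: "enn_powr (enn_powr x a) b = enn_powr x (a * b)"
  by (cases x) (auto simp: enn_powr_def powr_powr)

text \<open>Hoelder's inequality for finite sums: after division by the two sums, Young's inequality
  applies termwise and the bounds add up to a + b = 1. If a sum vanishes, so does every term on the
  left.\<close>

lemma sum_powr_mult_le:
  fixes x y :: "'b \<Rightarrow> real"
  assumes "finite S" and x: "\<And>i. i \<in> S \<Longrightarrow> 0 \<le> x i" and y: "\<And>i. i \<in> S \<Longrightarrow> 0 \<le> y i"
    and ab: "0 < a" "0 < b" "a + b = 1"
  shows "(\<Sum>i\<in>S. x i powr a * y i powr b) \<le> (\<Sum>i\<in>S. x i) powr a * (\<Sum>i\<in>S. y i) powr b"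
proof -
  define X Y where "X = (\<Sum>i\<in>S. x i)" and "Y = (\<Sum>i\<in>S. y i)"
  have X0: "0 \<le> X" and Y0: "0 \<le> Y"
    using x y by (auto simp: X_def Y_def intro: sum_nonneg)
  show ?thesis
  proof (cases "X = 0 \<or> Y = 0")
    case True
    then have "x i powr a * y i powr b = 0" if "i \<in> S" for i
      using that x y \<open>finite S\<close> by (auto simp: X_def Y_def sum_nonneg_eq_0_iff)
    then have "(\<Sum>i\<in>S. x i powr a * y i powr b) = 0"
      by (intro sum.neutral) blast
    then show ?thesis by simp
  next
    case False
    with X0 Y0 have XY: "0 < X" "0 < Y" by auto
    have "x i powr a * y i powr b \<le> X powr a * Y powr b * (a * (x i / X) + b * (y i / Y))"
      if "i \<in> S" for i
    proof (cases "x i = 0 \<or> y i = 0")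
      case True
      then show ?thesis
        using XY ab x[OF that] y[OF that] by auto
    next
      case False
      then have "(x i / X) powr a * (y i / Y) powr b \<le> a * (x i / X) + b * (y i / Y)"
        using XY ab x[OF that] y[OF that] by (intro Youngs_inequality_0) auto
      then have "X powr a * Y powr b * ((x i / X) powr a * (y i / Y) powr b)
          \<le> X powr a * Y powr b * (a * (x i / X) + b * (y i / Y))"
        by (intro mult_left_mono) auto
      also have "X powr a * Y powr b * ((x i / X) powr a * (y i / Y) powr b) = x i powr a * y i powr b"
        using XY x[OF that] y[OF that] by (simp add: powr_divide)
      finally show ?thesis .
    qed
    then have "(\<Sum>i\<in>S. x i powr a * y i powr b)
        \<le> (\<Sum>i\<in>S. X powr a * Y powr b * (a * (x i / X) + b * (y i / Y)))"
      by (rule sum_mono)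
    also have "\<dots> = X powr a * Y powr b * (a * (X / X) + b * (Y / Y))"
      by (simp add: X_def Y_def sum.distrib flip: sum_distrib_left sum_divide_distrib)
    also have "\<dots> = X powr a * Y powr b"
      using XY ab by simp
    finally show ?thesis
      by (simp add: X_def Y_def)
  qed
qed

text \<open>Each term is at most the total X, so x^\<theta> is at most x * X^(\<theta> - 1), and
  these bounds add up to X^\<theta>.\<close>

lemma sum_powr_le_powr_sum:
  fixes x :: "'b \<Rightarrow> real"
  assumes "finite S" and "\<And>i. i \<in> S \<Longrightarrow> 0 \<le> x i" and "1 \<le> \<theta>"
  shows "(\<Sum>i\<in>S. x i powr \<theta>) \<le> (\<Sum>i\<in>S. x i) powr \<theta>"
proof -
  define X where "X = (\<Sum>i\<in>S. x i)"
  have le: "x i \<le> X" if "i \<in> S" for i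
    unfolding X_def using assms that by (intro member_le_sum) auto
  have split: "z powr \<theta> = z * z powr (\<theta> - 1)" if "0 \<le> z" for z :: real
    using that by (cases "z = 0") (auto simp: powr_diff)
  have "(\<Sum>i\<in>S. x i powr \<theta>) \<le> (\<Sum>i\<in>S. x i * X powr (\<theta> - 1))"
    using assms le by (intro sum_mono) (auto simp: split intro!: mult_left_mono powr_mono2)
  also have "\<dots> = X powr \<theta>"
    using assms by (subst split) (auto simp: X_def sum_distrib_right intro: sum_nonneg)
  finally show ?thesis by (simp add: X_def)
qed

subsection \<open>Laminar families\<close>

definition laminar :: "'a set set \<Rightarrow> bool" where
  "laminar S \<longleftrightarrow> (\<forall>A\<in>S. \<forall>B\<in>S. A \<inter> B = {} \<or> A \<subseteq> B \<or> B \<subseteq> A)"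

lemma laminar_subset: "laminar S \<Longrightarrow> T \<subseteq> S \<Longrightarrow> laminar T"
  unfolding laminar_def by blast

text \<open>Peeling off minimal members shows that a family can be rebuilt from the outside in: no
  set arrives after one of its proper subsets. Stopping-time selections follow this order.\<close>

lemma finite_minimal_induct [consumes 1, case_names empty insert]:
  fixes S :: "'a set set"
  assumes "finite S" and "P {}"
    and step: "\<And>Q S. finite S \<Longrightarrow> Q \<notin> S \<Longrightarrow> (\<And>R. R \<in> S \<Longrightarrow> \<not> R \<subset> Q) \<Longrightarrow> P S \<Longrightarrow> P (insert Q S)"
  shows "P S"
  using \<open>finite S\<close>
proof (induction S rule: finite_psubset_induct)
  case (psubset S)
  show ?case
  proof (cases "S = {}")
    case False
    then obtain Q where Q: "Q \<in> S" "\<forall>R\<in>S. R \<subseteq> Q \<longrightarrow> Q = R"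
      using finite_has_minimal[OF psubset.hyps] by auto
    have "P (insert Q (S - {Q}))"
    proof (rule step)
      show "P (S - {Q})"
        using Q by (intro psubset.IH) auto
      show "\<not> R \<subset> Q" if "R \<in> S - {Q}" for R
        using Q that by blast
    qed (use psubset.hyps in auto)
    then show ?thesis
      using Q by (simp add: insert_absorb)
  qed (simp add: \<open>P {}\<close>)
qed

text \<open>Stopping-time selection: going from large sets to small ones, \<open>Q\<close> is kept
  exactly when no kept superset \<open>R\<close> already satisfies a Q \<le> A * a R. Kept sets
  control themselves since 1 \<le> A.\<close>

lemma principal_subfamily:
  fixes a :: "'a set \<Rightarrow> real"
  assumes "finite S" "\<And>Q. Q \<in> S \<Longrightarrow> 0 \<le> a Q" "1 \<le> A"
  shows "\<exists>P\<subseteq>S. (\<forall>Q\<in>S. \<exists>R\<in>P. Q \<subseteq> R \<and> a Q \<le> A * a R)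
    \<and> (\<forall>Q\<in>P. \<forall>R\<in>P. Q \<subset> R \<longrightarrow> A * a R < a Q)"
  using assms(1,2)
proof (induction S rule: finite_minimal_induct)
  case (insert Q S)
  then obtain P where P: "P \<subseteq> S" "\<forall>Q\<in>S. \<exists>R\<in>P. Q \<subseteq> R \<and> a Q \<le> A * a R"
    "\<forall>Q\<in>P. \<forall>R\<in>P. Q \<subset> R \<longrightarrow> A * a R < a Q"
    by auto
  show ?case
  proof (cases "\<exists>R\<in>P. Q \<subseteq> R \<and> a Q \<le> A * a R")
    case True
    with P show ?thesis by (intro exI[of _ P]) auto
  next
    case False
    have "a Q \<le> A * a Q"
      using insert.prems[of Q] mult_right_mono[OF assms(3), of "a Q"] by simp
    moreover have "\<forall>R\<in>P. \<not> R \<subset> Q"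
      using P(1) insert.hyps(3) by blast
    moreover have "\<forall>R\<in>P. Q \<subset> R \<longrightarrow> A * a R < a Q"
      using False by (auto simp: not_le)
    ultimately have "\<forall>Q'\<in>insert Q P. \<forall>R\<in>insert Q P. Q' \<subset> R \<longrightarrow> A * a R < a Q'"
      using P(3) by (simp add: ball_simps)
    moreover have "\<forall>Q'\<in>insert Q S. \<exists>R\<in>insert Q P. Q' \<subseteq> R \<and> a Q' \<le> A * a R"
      using P(2) \<open>a Q \<le> A * a Q\<close> by auto
    ultimately show ?thesis
      using P(1) by (intro exI[of _ "insert Q P"] conjI) auto
  qed
qed auto

text \<open>In the order from large to small a new set either lies in one already present, so the
  union does not change, or is disjoint from the union, so both measures add.\<close>

lemma measure_Union_laminar_le:
  fixes S :: "'a set set"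
  assumes "finite S" "laminar S" "S \<subseteq> fmeasurable M" "S \<subseteq> fmeasurable N"
    and "\<And>Q. Q \<in> S \<Longrightarrow> c * measure M Q \<le> measure N Q"
  shows "c * measure M (\<Union>S) \<le> measure N (\<Union>S)"
  using assms
proof (induction S rule: finite_minimal_induct)
  case (insert Q S)
  have IH: "c * measure M (\<Union>S) \<le> measure N (\<Union>S)"
    using insert.prems by (intro insert.IH) (auto intro: laminar_subset)
  show ?case
  proof (cases "\<exists>R\<in>S. Q \<subseteq> R")
    case True
    then have "\<Union>(insert Q S) = \<Union>S" by auto
    with IH show ?thesis by simp
  next
    case False
    have disj: "Q \<inter> \<Union>S = {}"
    proof -
      have "Q \<inter> R = {}" if "R \<in> S" for R
      proof -
        have "Q \<inter> R = {} \<or> Q \<subseteq> R \<or> R \<subseteq> Q"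
          using insert.prems(1) that by (auto simp: laminar_def)
        then show ?thesis
          using insert.hyps(2) insert.hyps(3)[OF that] False that by blast
      qed
      then show ?thesis by auto
    qed
    have U: "\<Union>S \<in> fmeasurable M" "\<Union>S \<in> fmeasurable N"
      using insert.prems insert.hyps by (auto intro!: fmeasurable.finite_Union)
    have "measure M (\<Union>(insert Q S)) = measure M Q + measure M (\<Union>S)"
      "measure N (\<Union>(insert Q S)) = measure N Q + measure N (\<Union>S)"
      using insert.prems U disj by (auto intro!: measure_Union simp: fmeasurable_def)
    moreover have "c * measure M Q \<le> measure N Q"
      using insert.prems by auto
    ultimately show ?thesis
      using IH by (simp add: algebra_simps)
  qed
qed auto

text \<open>The Carleson packing condition follows by peeling off one maximal set at a time.\<close>

lemma sum_measure_le_Union: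
  fixes S :: "'a set set"
  assumes "finite S" "laminar S" "S \<subseteq> fmeasurable M"
    and half: "\<And>R. R \<in> S \<Longrightarrow> measure M (\<Union>{Q\<in>S. Q \<subset> R}) \<le> measure M R / 2"
  shows "(\<Sum>Q\<in>S. measure M Q) \<le> 2 * measure M (\<Union>S)"
  using assms
proof (induction S rule: finite_psubset_induct)
  case (psubset S)
  show ?case
  proof (cases "S = {}")
    case False
    then obtain R where R: "R \<in> S" "\<forall>Q\<in>S. R \<subseteq> Q \<longrightarrow> R = Q"
      using finite_has_maximal[OF psubset.hyps] by auto
    have cover: "\<Union>S = R \<union> \<Union>{Q\<in>S. \<not> Q \<subseteq> R}"
      using R(1) by blast
    define S1 where "S1 = {Q\<in>S. Q \<subset> R}"
    define S2 where "S2 = {Q\<in>S. \<not> Q \<subseteq> R}"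
    have S: "S = insert R (S1 \<union> S2)" "R \<notin> S1 \<union> S2" "S1 \<inter> S2 = {}"
      using R by (auto simp: S1_def S2_def)
    have sub: "S1 \<subset> S" "S2 \<subset> S"
      using R by (auto simp: S1_def S2_def)
    have fin: "finite S1" "finite S2"
      using psubset.hyps sub finite_subset by auto
    have IH: "(\<Sum>Q\<in>T. measure M Q) \<le> 2 * measure M (\<Union>T)" if "T \<subset> S" for T
    proof (rule psubset.IH[OF that])
      show "laminar T" "T \<subseteq> fmeasurable M"
        using psubset.prems that by (auto intro: laminar_subset)
      fix R' assume "R' \<in> T"
      have "measure M (\<Union>{Q\<in>T. Q \<subset> R'}) \<le> measure M (\<Union>{Q\<in>S. Q \<subset> R'})"
        using psubset.prems psubset.hyps that
        by (intro measure_mono_fmeasurable fmeasurableD fmeasurable.finite_Union)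
          (auto intro: finite_subset[OF _ psubset.hyps])
      also have "\<dots> \<le> measure M R' / 2"
        using psubset.prems that \<open>R' \<in> T\<close> by auto
      finally show "measure M (\<Union>{Q\<in>T. Q \<subset> R'}) \<le> measure M R' / 2" .
    qed
    have disj: "R \<inter> \<Union>S2 = {}"
      using R psubset.prems(1) unfolding laminar_def S2_def by blast
    have "measure M (\<Union>S) = measure M (R \<union> \<Union>S2)"
      using cover by (simp add: S2_def)
    also have "\<dots> = measure M R + measure M (\<Union>S2)"
    proof -
      have "\<Union>S2 \<in> fmeasurable M" "R \<in> fmeasurable M"
        using psubset.prems fin sub R by (auto intro!: fmeasurable.finite_Union)
      with disj show ?thesis
        by (intro measure_Union) (auto simp: fmeasurable_def)
    qed
    finally have U: "measure M (\<Union>S) = measure M R + measure M (\<Union>S2)" .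
    have "(\<Sum>Q\<in>S. measure M Q) = measure M R + ((\<Sum>Q\<in>S1. measure M Q) + (\<Sum>Q\<in>S2. measure M Q))"
      unfolding S(1) using S(2,3) fin by (simp add: sum.union_disjoint)
    \<comment> \<open>The sets strictly inside \<open>R\<close> have total measure at most twice
      that of their union, hence at most that of \<open>R\<close> by \<open>half\<close>. Together
      with \<open>R\<close> this gives twice the measure of \<open>R\<close>.\<close>
    also have "\<dots> \<le> measure M R + (measure M R + 2 * measure M (\<Union>S2))"
      using IH[OF sub(1)] IH[OF sub(2)] psubset.prems(3)[OF R(1)] by (simp add: S1_def)
    finally show ?thesis using U by simp
  qed simp
qed

text \<open>The members whose \<open>N1\<close>-density exceeds four times that of \<open>R\<close>
  cover at most a quarter of \<open>R\<close>, since their \<open>N1\<close>-mass cannot exceed that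
  of \<open>R\<close>; likewise for \<open>N2\<close>. So the members strictly inside
  \<open>R\<close> cover at most half of it, as \<open>sum_measure_le_Union\<close> asks.\<close>

lemma sparse_packing:
  fixes S :: "'a set set"
  assumes S: "finite S" "laminar S" "S \<subseteq> fmeasurable M" "S \<subseteq> fmeasurable N1" "S \<subseteq> fmeasurable N2"
    and sets: "sets N1 = sets M" "sets N2 = sets M"
    and pos: "\<And>Q. Q \<in> S \<Longrightarrow> 0 < measure M Q"
    and jump: "\<And>Q R. Q \<in> S \<Longrightarrow> R \<in> S \<Longrightarrow> Q \<subset> R \<Longrightarrow>
      4 * (measure N1 R / measure M R) < measure N1 Q / measure M Q \<or>
      4 * (measure N2 R / measure M R) < measure N2 Q / measure M Q"
    and R: "R \<in> S"
  shows "(\<Sum>Q\<in>{Q\<in>S. Q \<subseteq> R}. measure M Q) \<le> 2 * measure M R"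
proof -
  have quarter: "measure M (\<Union>{Q\<in>S. Q \<subset> R \<and> 4 * (measure N R / measure M R) < measure N Q / measure M Q})
      \<le> measure M R / 4" (is "measure M (\<Union>?T) \<le> _")
    if R: "R \<in> S" and N: "S \<subseteq> fmeasurable N" "sets N = sets M" for R N
  proof (cases "measure N R = 0")
    \<comment> \<open>Here the threshold \<open>c\<close> used below would be 0 and could not be
      cancelled, but no density can jump because \<open>N\<close> vanishes on every member inside
      \<open>R\<close>.\<close>
    case True
    have empty: "?T = {}"
    proof (rule equals0I)
      fix Q assume "Q \<in> ?T"
      then have Q: "Q \<in> S" "Q \<subset> R" "0 < measure N Q / measure M Q"
        by (auto simp: True)
      have "measure N Q \<le> measure N R"
        using Q R N by (intro measure_mono_fmeasurable) (auto intro: fmeasurableD)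
      with True Q show False
        by (auto simp: zero_less_divide_iff not_less measure_le_0_iff)
    qed
    show ?thesis unfolding empty by simp
  next
    case False
    then have nR: "0 < measure N R" by (simp add: less_le)
    define c where "c = 4 * (measure N R / measure M R)"
    have fin: "finite ?T" using S by auto
    have "c * measure M (\<Union>?T) \<le> measure N (\<Union>?T)"
    proof (rule measure_Union_laminar_le[OF fin])
      show "laminar ?T" using S by (auto intro: laminar_subset)
      show "c * measure M Q \<le> measure N Q" if "Q \<in> ?T" for Q
        using that pos[of Q] by (auto simp: c_def field_simps)
    qed (use S N in auto)
    also have "\<dots> \<le> measure N R"
    proof (rule measure_mono_fmeasurable)
      show "\<Union>?T \<in> sets N"
        using fin N by (intro sets.finite_Union) auto
    qed (use R N in auto)
    finally have "c * measure M (\<Union>?T) \<le> measure N R" .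
    moreover have "c * (measure M R / 4) = measure N R" "0 < c"
      using nR pos[OF R] by (auto simp: c_def)
    ultimately have "c * measure M (\<Union>?T) \<le> c * (measure M R / 4)"
      by linarith
    then show ?thesis
      using \<open>0 < c\<close> by (rule mult_left_le_imp_le)
  qed
  have "(\<Sum>Q\<in>{Q\<in>S. Q \<subseteq> R}. measure M Q) \<le> 2 * measure M (\<Union>{Q\<in>S. Q \<subseteq> R})"
  proof (rule sum_measure_le_Union)
    show "laminar {Q\<in>S. Q \<subseteq> R}" using S by (auto intro: laminar_subset)
    fix R' assume "R' \<in> {Q\<in>S. Q \<subseteq> R}"
    then have R': "R' \<in> S" "R' \<subseteq> R" by auto
    let ?A = "\<lambda>N. \<Union>{Q\<in>S. Q \<subset> R' \<and> 4 * (measure N R' / measure M R') < measure N Q / measure M Q}"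
    have A: "?A N \<in> fmeasurable M" for N
      using S by (intro fmeasurable.finite_Union) auto
    have "measure M (\<Union>{Q \<in> {Q\<in>S. Q \<subseteq> R}. Q \<subset> R'}) \<le> measure M (?A N1 \<union> ?A N2)"
    proof (rule measure_mono_fmeasurable)
      show "\<Union>{Q \<in> {Q\<in>S. Q \<subseteq> R}. Q \<subset> R'} \<subseteq> ?A N1 \<union> ?A N2"
        using jump R' by blast
      show "\<Union>{Q \<in> {Q\<in>S. Q \<subseteq> R}. Q \<subset> R'} \<in> sets M"
        using S by (intro sets.finite_Union) auto
    qed (use A in auto)
    also have "\<dots> \<le> measure M (?A N1) + measure M (?A N2)"
      using A by (intro measure_Un_le) auto
    also have "\<dots> \<le> measure M R' / 4 + measure M R' / 4"
      using quarter[OF R'(1) S(4) sets(1)] quarter[OF R'(1) S(5) sets(2)] by (rule add_mono)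
    finally show "measure M (\<Union>{Q \<in> {Q\<in>S. Q \<subseteq> R}. Q \<subset> R'}) \<le> measure M R' / 2" by simp
  qed (use S in auto)
  also have "\<Union>{Q\<in>S. Q \<subseteq> R} = R" using R by auto
  finally show ?thesis .
qed

subsection \<open>The Carleson embedding\<close>

lemma borel_measurable_max_0:
  fixes \<Psi> :: "real \<Rightarrow> real"
  assumes "continuous_on {0..} \<Psi>"
  shows "(\<lambda>t. \<Psi> (max 0 t)) \<in> borel_measurable borel"
  by (intro borel_measurable_continuous_onI continuous_on_compose2[OF assms] continuous_intros) auto

text \<open>The cutoff \<open>c\<close> is the starting point of the integral in the
  \<open>B\<close> condition. What lies below it is later absorbed in the constant
  \<open>\<Psi> c\<close>.\<close>

definition tail_ratio :: "(real \<Rightarrow> real) \<Rightarrow> real \<Rightarrow> real \<Rightarrow> real \<Rightarrow> real" where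
  "tail_ratio \<Psi> p c t = (if c < t then \<Psi> t / t powr p else 0)"

lemma tail_ratio_nonneg: "(\<And>t. 0 \<le> t \<Longrightarrow> 0 \<le> \<Psi> t) \<Longrightarrow> 0 < c \<Longrightarrow> 0 \<le> tail_ratio \<Psi> p c t"
  by (auto simp: tail_ratio_def)

lemma borel_measurable_tail_ratio:
  assumes "continuous_on {0..} \<Psi>" "0 < c"
  shows "tail_ratio \<Psi> p c \<in> borel_measurable borel"
proof -
  have [measurable]: "(\<lambda>t. \<Psi> (max 0 t)) \<in> borel_measurable borel"
    using assms(1) by (rule borel_measurable_max_0)
  have "tail_ratio \<Psi> p c = (\<lambda>t. if c < t then \<Psi> (max 0 t) / t powr p else 0)"
    using assms(2) by (auto simp: tail_ratio_def fun_eq_iff)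
  then show ?thesis by simp
qed

text \<open>Comparison of a lacunary sum with an integral. The term at t = s / a is at most a
  constant times the integral of the \<open>B\<close> integrand over [t, 2 t). Separation by a
  factor two makes these intervals disjoint, and they lie in {c..} unless the cutoff kills the
  term.\<close>

lemma tail_ratio_separated_sum:
  fixes \<Psi> :: "real \<Rightarrow> real"
  assumes cont: "continuous_on {0..} \<Psi>" and mono: "mono_on {0..} \<Psi>" and \<Psi>0: "0 \<le> \<Psi> 0"
    and pos: "0 < p" "0 < c" "0 < \<theta>"
    and fin: "(\<integral>\<^sup>+ t\<in>{c..}. ennreal (\<Psi> t powr \<theta> * t powr (- (p * \<theta>) - 1)) \<partial>lborel) < \<infinity>"
  shows "\<exists>D\<ge>0. \<forall>s T. finite T \<longrightarrow> 0 \<le> s \<longrightarrow> (\<forall>a\<in>T. 0 < a) \<longrightarrow> (\<forall>a\<in>T. \<forall>b\<in>T. a < b \<longrightarrow> 2 * a < b)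
    \<longrightarrow> (\<Sum>a\<in>T. tail_ratio \<Psi> p c (s / a) powr \<theta>) \<le> D"
proof -
  define W where "W = (\<lambda>t. ennreal (\<Psi> (max 0 t) powr \<theta> * t powr (- (p * \<theta>) - 1)))"
  have [measurable]: "(\<lambda>t. \<Psi> (max 0 t)) \<in> borel_measurable borel"
    using cont by (rule borel_measurable_max_0)
  have [measurable]: "W \<in> borel_measurable lborel"
    unfolding W_def by measurable
  have \<Psi>_nonneg: "0 \<le> \<Psi> t" if "0 \<le> t" for t
    using mono_onD[OF mono, of 0 t] \<Psi>0 that by auto
  define J where "J = (\<integral>\<^sup>+ t\<in>{c..}. W t \<partial>lborel)"
  have "J = (\<integral>\<^sup>+ t\<in>{c..}. ennreal (\<Psi> t powr \<theta> * t powr (- (p * \<theta>) - 1)) \<partial>lborel)"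
    unfolding J_def W_def using pos by (intro nn_integral_cong) (auto simp: indicator_def)
  with fin have J: "J = ennreal (enn2real J)" by auto
  \<comment> \<open>On [t, 2 t) the decreasing power is bounded below by its value at 2 t; the
    factor \<open>K\<close> restores its value at t.\<close>
  define K where "K = 2 powr (p * \<theta> + 1)"
  have K: "0 < K" by (simp add: K_def)
  have point: "ennreal (tail_ratio \<Psi> p c t powr \<theta>) \<le> ennreal K * (\<integral>\<^sup>+ \<tau>\<in>{t..<2*t}. W \<tau> \<partial>lborel)"
    if "c < t" for t
  proof -
    have t: "0 < t" using that pos by simp
    define w where "w = \<Psi> t powr \<theta> * (2 * t) powr (- (p * \<theta>) - 1)"
    have "ennreal (t * w) = (\<integral>\<^sup>+ \<tau>\<in>{t..<2*t}. ennreal w \<partial>lborel)"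
    proof -
      have "0 \<le> w" by (simp add: w_def)
      then show ?thesis
        using t by (subst nn_integral_cmult_indicator) (auto simp: ennreal_mult mult.commute)
    qed
    also have "\<dots> \<le> (\<integral>\<^sup>+ \<tau>\<in>{t..<2*t}. W \<tau> \<partial>lborel)"
    proof (intro nn_integral_mono)
      fix \<tau>
      have "w \<le> \<Psi> \<tau> powr \<theta> * \<tau> powr (- (p * \<theta>) - 1)" if "t \<le> \<tau>" "\<tau> < 2 * t"
      proof -
        have "0 \<le> \<Psi> t" "\<Psi> t \<le> \<Psi> \<tau>"
          using \<Psi>_nonneg[of t] mono_onD[OF mono, of t \<tau>] t that by auto
        then have "\<Psi> t powr \<theta> \<le> \<Psi> \<tau> powr \<theta>"
          using pos by (intro powr_mono2) auto
        moreover have "(2 * t) powr (- (p * \<theta>) - 1) \<le> \<tau> powr (- (p * \<theta>) - 1)"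
        proof (rule powr_mono2')
          have "0 \<le> p * \<theta>" using pos by simp
          then show "- (p * \<theta>) - 1 \<le> 0" by simp
        qed (use t that in auto)
        ultimately show ?thesis
          unfolding w_def by (rule mult_mono) auto
      qed
      then show "ennreal w * indicator {t..<2*t} \<tau> \<le> W \<tau> * indicator {t..<2*t} \<tau>"
        using t by (auto simp: W_def indicator_def intro!: ennreal_leI)
    qed
    finally have "ennreal K * ennreal (t * w) \<le> ennreal K * (\<integral>\<^sup>+ \<tau>\<in>{t..<2*t}. W \<tau> \<partial>lborel)"
      by (rule mult_left_mono) simp
    moreover have "K * (t * w) = tail_ratio \<Psi> p c t powr \<theta>"
    proof -
      have "K * (t * w) = \<Psi> t powr \<theta> * (t * (K * (2 * t) powr (- (p * \<theta>) - 1)))"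
        unfolding w_def by (simp only: mult_ac)
      moreover have "K * (2 * t) powr (- (p * \<theta>) - 1) = t powr (- (p * \<theta>) - 1)"
        using t by (simp add: K_def powr_mult mult.assoc[symmetric] powr_add[symmetric])
      moreover have "t * t powr (- (p * \<theta>) - 1) = t powr (- (p * \<theta>))"
        using t by (simp add: powr_diff)
      moreover have "tail_ratio \<Psi> p c t powr \<theta> = \<Psi> t powr \<theta> * t powr (- (p * \<theta>))"
        using t that \<Psi>_nonneg[of t]
        by (simp add: tail_ratio_def powr_divide powr_powr powr_minus divide_simps)
      ultimately show ?thesis
        by (simp only:)
    qed
    ultimately show ?thesis
      using K by (simp add: ennreal_mult'[symmetric])
  qed
  have main: "(\<Sum>a\<in>T. tail_ratio \<Psi> p c (s / a) powr \<theta>) \<le> K * enn2real J"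
    if T: "finite T" and s: "0 \<le> s" and Tpos: "\<forall>a\<in>T. 0 < a"
      and sep: "\<forall>a\<in>T. \<forall>b\<in>T. a < b \<longrightarrow> 2 * a < b" for s T
  proof -
    define T' where "T' = {a\<in>T. c < s / a}"
    have fT': "finite T'" using T by (simp add: T'_def)
    have disj1: "{s / a..<2 * (s / a)} \<inter> {s / b..<2 * (s / b)} = {}"
      if "a \<in> T'" "b \<in> T'" "a < b" for a b
    proof -
      have "2 * a < b" "0 < a" using that sep Tpos by (auto simp: T'_def)
      then have "2 * (s / b) \<le> s / a"
        using s mult_right_mono[of "2 * a" b s] by (simp add: field_simps)
      then show ?thesis by auto
    qed
    have disj: "disjoint_family_on (\<lambda>a. {s / a..<2 * (s / a)}) T'"
      unfolding disjoint_family_on_def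
      by (metis disj1 Int_commute linorder_neqE_linordered_idom)
    have "ennreal (\<Sum>a\<in>T. tail_ratio \<Psi> p c (s / a) powr \<theta>)
        = ennreal (\<Sum>a\<in>T'. tail_ratio \<Psi> p c (s / a) powr \<theta>)"
      unfolding T'_def using T
      by (intro arg_cong[where f = ennreal] sum.mono_neutral_right) (auto simp: tail_ratio_def)
    also have "\<dots> = (\<Sum>a\<in>T'. ennreal (tail_ratio \<Psi> p c (s / a) powr \<theta>))"
      by simp
    also have "\<dots> \<le> (\<Sum>a\<in>T'. ennreal K * (\<integral>\<^sup>+ \<tau>\<in>{s/a..<2*(s/a)}. W \<tau> \<partial>lborel))"
      by (intro sum_mono point) (auto simp: T'_def)
    also have "\<dots> = ennreal K * (\<integral>\<^sup>+ \<tau>. (\<Sum>a\<in>T'. W \<tau> * indicator {s/a..<2*(s/a)} \<tau>) \<partial>lborel)"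
      by (simp add: sum_distrib_left nn_integral_sum)
    also have "\<dots> \<le> ennreal K * J"
      unfolding J_def
    proof (intro mult_left_mono nn_integral_mono)
      fix \<tau> :: real
      have "(\<Sum>a\<in>T'. W \<tau> * indicator {s/a..<2*(s/a)} \<tau>)
          = W \<tau> * indicator (\<Union>a\<in>T'. {s/a..<2*(s/a)}) \<tau>"
        unfolding indicator_UN_disjoint[OF fT' disj] by (rule sum_distrib_left[symmetric])
      also have "\<dots> \<le> W \<tau> * indicator {c..} \<tau>"
        by (intro mult_left_mono) (auto simp: indicator_def T'_def split: if_splits)
      finally show "(\<Sum>a\<in>T'. W \<tau> * indicator {s/a..<2*(s/a)} \<tau>) \<le> W \<tau> * indicator {c..} \<tau>" .
    qed simp
    also have "\<dots> = ennreal (K * enn2real J)"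
      using K by (subst J) (simp add: ennreal_mult')
    finally show ?thesis
      using K by (subst (asm) ennreal_le_iff) auto
  qed
  show ?thesis
    using main K by (intro exI[of _ "K * enn2real J"]) auto
qed

text \<open>A substitute for Jensen's inequality: optimise in \<open>e\<close>.\<close>

lemma powr_le_of_parametric_bound:
  fixes X N z \<theta> :: real
  assumes "0 \<le> X" "0 \<le> N" "0 \<le> z" "N = 0 \<Longrightarrow> z = 0"
    and e: "\<And>e. 0 < e \<Longrightarrow> X \<le> e * N + e powr (1 - \<theta>) * z"
  shows "X powr \<theta> \<le> 2 powr \<theta> * N powr (\<theta> - 1) * z"
proof (cases "X = 0")
  case False
  then have X: "0 < X" using assms by simp
  have N: "0 < N"
    using e[of 1] assms X by (cases "N = 0") auto
  \<comment> \<open>This value of \<open>e\<close> makes the first term e * N equal to X / 2, which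
    is absorbed on the left.\<close>
  define y where "y = X / (2 * N)"
  have y: "0 < y" using X N by (simp add: y_def)
  have "X \<le> X / 2 + y powr (1 - \<theta>) * z"
    using e[OF y] N by (simp add: y_def)
  then have "y powr (\<theta> - 1) * (X / 2) \<le> y powr (\<theta> - 1) * (y powr (1 - \<theta>) * z)"
    by (intro mult_left_mono) auto
  also have "\<dots> = z"
    using y by (simp add: mult.assoc[symmetric] powr_add[symmetric])
  finally have 1: "y powr (\<theta> - 1) * (X / 2) \<le> z" .
  have "X powr \<theta> = (2 * N) powr (\<theta> - 1) * y powr (\<theta> - 1) * X"
    using X N by (simp add: y_def powr_divide powr_diff)
  also have "\<dots> = 2 powr \<theta> * N powr (\<theta> - 1) * (y powr (\<theta> - 1) * (X / 2))"
    using N by (simp add: powr_mult powr_diff)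
  also have "\<dots> \<le> 2 powr \<theta> * N powr (\<theta> - 1) * z"
    using 1 by (intro mult_left_mono) auto
  finally show ?thesis .
qed (use assms in auto)

text \<open>Either y is at most e, or y = y^(1 - \<theta>) * y^\<theta> with a nonpositive first
  exponent. Applied to \<eta>, this gives the bound that \<open>powr_le_of_parametric_bound\<close>
  optimises.\<close>

lemma powr_parametric_ge:
  fixes y e \<theta> :: real
  assumes "0 \<le> y" "0 < e" "1 \<le> \<theta>"
  shows "y \<le> e + e powr (1 - \<theta>) * y powr \<theta>"
proof (cases "y \<le> e")
  case True
  then show ?thesis by (simp add: add_increasing2)
next
  case False
  then have "y = y powr (1 - \<theta>) * y powr \<theta>"
    using assms by (simp add: powr_add[symmetric])
  also have "\<dots> \<le> e powr (1 - \<theta>) * y powr \<theta>"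
    using False assms by (intro mult_right_mono powr_mono2') auto
  finally show ?thesis using assms by simp
qed

text \<open>Packing reduces the sum to a subfamily along whose chains \<open>m\<close> more than
  doubles. There the test condition is raised to the power \<theta> at the cost of N^(\<theta> - 1),
  leaving integrals of F^p * \<eta>(F / m R)^\<theta>, whose sum is at most D * N by the lacunary
  bound at each point.\<close>

lemma carleson_embedding:
  fixes F :: "'a \<Rightarrow> real" and \<eta> :: "real \<Rightarrow> real" and m :: "'a set \<Rightarrow> real"
  assumes S: "finite S" "laminar S" "S \<subseteq> fmeasurable M"
    and packing: "\<And>R. R \<in> S \<Longrightarrow> (\<Sum>Q\<in>{Q\<in>S. Q \<subseteq> R}. measure M Q) \<le> 2 * measure M R"
    and F [measurable]: "F \<in> borel_measurable M" and F0: "\<And>x. 0 \<le> F x"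
    and \<eta> [measurable]: "\<eta> \<in> borel_measurable borel" and \<eta>0: "\<And>t. 0 \<le> \<eta> t"
    and p: "0 < p" and \<theta>: "1 \<le> \<theta>" and m: "\<And>Q. Q \<in> S \<Longrightarrow> 0 < m Q"
    and N: "(\<integral>\<^sup>+ x. ennreal (F x powr p) \<partial>M) = ennreal N" "0 \<le> N"
    and test: "\<And>Q. Q \<in> S \<Longrightarrow> ennreal (measure M Q * m Q powr p)
        \<le> (\<integral>\<^sup>+ x\<in>Q. ennreal (F x powr p * \<eta> (F x / m Q)) \<partial>M)"
    and D: "0 \<le> D" "\<And>s T. finite T \<Longrightarrow> 0 \<le> s \<Longrightarrow> (\<forall>a\<in>T. 0 < a) \<Longrightarrow>
        (\<forall>a\<in>T. \<forall>b\<in>T. a < b \<longrightarrow> 2 * a < b) \<Longrightarrow> (\<Sum>a\<in>T. \<eta> (s / a) powr \<theta>) \<le> D"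
  shows "(\<Sum>Q\<in>S. (measure M Q * m Q powr p) powr \<theta>) \<le> 2 powr (p * \<theta> + 2 * \<theta>) * D * N powr \<theta>"
proof -
  obtain P where P: "P \<subseteq> S" "\<forall>Q\<in>S. \<exists>R\<in>P. Q \<subseteq> R \<and> m Q \<le> 2 * m R"
    "\<forall>Q\<in>P. \<forall>R\<in>P. Q \<subset> R \<longrightarrow> 2 * m R < m Q"
    using principal_subfamily[of S m 2] S m by (metis less_imp_le one_le_numeral)
  have finP: "finite P" using P(1) S(1) by (rule finite_subset)
  define X where "X = (\<lambda>Q. measure M Q * m Q powr p)"
  \<comment> \<open>Each \<open>Q\<close> is charged to a selected \<open>R\<close> with m Q \<le> 2
    * m R. The doubling costs 2^(p * \<theta>), and the packing bound, once the power \<theta> is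
    pulled out of the sum, costs 2^\<theta>.\<close>
  have reduce: "(\<Sum>Q\<in>S. X Q powr \<theta>) \<le> 2 powr (p * \<theta> + \<theta>) * (\<Sum>R\<in>P. X R powr \<theta>)"
  proof -
    have "(\<Sum>Q\<in>S. X Q powr \<theta>)
        \<le> (\<Sum>Q\<in>S. \<Sum>R\<in>P. if Q \<subseteq> R then (measure M Q * (2 * m R) powr p) powr \<theta> else 0)"
    proof (intro sum_mono)
      fix Q assume Q: "Q \<in> S"
      then obtain R where R: "R \<in> P" "Q \<subseteq> R" "m Q \<le> 2 * m R" using P(2) by auto
      have "X Q powr \<theta> \<le> (measure M Q * (2 * m R) powr p) powr \<theta>"
        unfolding X_def using R m[OF Q] p \<theta>
        by (intro powr_mono2 mult_left_mono mult_nonneg_nonneg) auto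
      also have "\<dots> = (if Q \<subseteq> R then (measure M Q * (2 * m R) powr p) powr \<theta> else 0)"
        using R by simp
      also have "\<dots> \<le> (\<Sum>R\<in>P. if Q \<subseteq> R then (measure M Q * (2 * m R) powr p) powr \<theta> else 0)"
        using R finP by (intro member_le_sum) auto
      finally show "X Q powr \<theta> \<le> (\<Sum>R\<in>P. if Q \<subseteq> R then (measure M Q * (2 * m R) powr p) powr \<theta> else 0)" .
    qed
    also have "\<dots> = (\<Sum>R\<in>P. \<Sum>Q\<in>S. if Q \<subseteq> R then (measure M Q * (2 * m R) powr p) powr \<theta> else 0)"
      by (rule sum.swap)
    also have "\<dots> \<le> (\<Sum>R\<in>P. 2 powr (p * \<theta> + \<theta>) * X R powr \<theta>)"
    proof (intro sum_mono)
      fix R assume R: "R \<in> P"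
      then have mR: "0 < m R" using P m by auto
      have "(\<Sum>Q\<in>S. if Q \<subseteq> R then (measure M Q * (2 * m R) powr p) powr \<theta> else 0)
          = (\<Sum>Q\<in>{Q\<in>S. Q \<subseteq> R}. (measure M Q * (2 * m R) powr p) powr \<theta>)"
        using S by (simp add: sum.inter_filter)
      also have "\<dots> \<le> (\<Sum>Q\<in>{Q\<in>S. Q \<subseteq> R}. measure M Q * (2 * m R) powr p) powr \<theta>"
        using S \<theta> by (intro sum_powr_le_powr_sum) auto
      also have "\<dots> \<le> (2 * measure M R * (2 * m R) powr p) powr \<theta>"
        using packing[of R] P R \<theta>
        by (intro powr_mono2) (auto simp: sum_distrib_right[symmetric] intro!: mult_right_mono mult_nonneg_nonneg sum_nonneg)
      also have "\<dots> = 2 powr (p * \<theta> + \<theta>) * X R powr \<theta>"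
        using mR by (simp add: X_def powr_mult powr_powr powr_add)
      finally show "(\<Sum>Q\<in>S. if Q \<subseteq> R then (measure M Q * (2 * m R) powr p) powr \<theta> else 0)
          \<le> 2 powr (p * \<theta> + \<theta>) * X R powr \<theta>" .
    qed
    finally show ?thesis by (simp add: sum_distrib_left)
  qed
  define Z where "Z = (\<lambda>R. \<integral>\<^sup>+ x\<in>R. ennreal (F x powr p * \<eta> (F x / m R) powr \<theta>) \<partial>M)"
  \<comment> \<open>By laminarity the selected sets through \<open>x\<close> form a chain, so
    distinct ones have values of \<open>m\<close> more than a factor two apart. In particular
    \<open>m\<close> is injective on them, and the sum over sets is a sum over separated
    values.\<close>
  have overlap: "(\<Sum>R\<in>{R\<in>P. x \<in> R}. \<eta> (F x / m R) powr \<theta>) \<le> D" for x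
  proof -
    let ?C = "{R\<in>P. x \<in> R}"
    have chain: "Q = R \<or> 2 * m R < m Q \<or> 2 * m Q < m R" if "Q \<in> ?C" "R \<in> ?C" for Q R
    proof -
      have "Q \<inter> R \<noteq> {}" using that by auto
      then have "Q \<subseteq> R \<or> R \<subseteq> Q" using S(2) P(1) that unfolding laminar_def by blast
      then show ?thesis using P(3) that by auto
    qed
    have mpos: "0 < m R" if "R \<in> ?C" for R using that P m by auto
    have inj: "inj_on m ?C"
    proof (rule inj_onI)
      fix Q R assume "Q \<in> ?C" "R \<in> ?C" "m Q = m R"
      then show "Q = R" using chain[of Q R] mpos[of Q] by auto
    qed
    have "(\<Sum>R\<in>?C. \<eta> (F x / m R) powr \<theta>) = (\<Sum>a\<in>m ` ?C. \<eta> (F x / a) powr \<theta>)"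
      by (simp add: sum.reindex[OF inj])
    also have "\<dots> \<le> D"
    proof (rule D(2))
      show "\<forall>a\<in>m ` ?C. \<forall>b\<in>m ` ?C. a < b \<longrightarrow> 2 * a < b"
      proof clarify
        fix Q R assume "Q \<in> P" "x \<in> Q" "R \<in> P" "x \<in> R" "m Q < m R"
        then show "2 * m Q < m R" using chain[of Q R] mpos[of Q] by auto
      qed
    qed (use finP F0 mpos in auto)
    finally show ?thesis .
  qed
  have Zsum: "(\<Sum>R\<in>P. Z R) \<le> ennreal (D * N)"
  proof -
    have [measurable]: "R \<in> sets M" if "R \<in> P" for R
      using that P S by (auto intro: fmeasurableD)
    have "(\<Sum>R\<in>P. Z R) = (\<integral>\<^sup>+ x. (\<Sum>R\<in>P. ennreal (F x powr p * \<eta> (F x / m R) powr \<theta>) * indicator R x) \<partial>M)"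
      unfolding Z_def by (rule nn_integral_sum[symmetric]) measurable
    also have "\<dots> \<le> (\<integral>\<^sup>+ x. ennreal D * ennreal (F x powr p) \<partial>M)"
    proof (rule nn_integral_mono)
      fix x
      have "(\<Sum>R\<in>P. ennreal (F x powr p * \<eta> (F x / m R) powr \<theta>) * indicator R x)
          = (\<Sum>R\<in>P. if x \<in> R then ennreal (F x powr p * \<eta> (F x / m R) powr \<theta>) else 0)"
        by (intro sum.cong) auto
      also have "\<dots> = (\<Sum>R\<in>{R\<in>P. x \<in> R}. ennreal (F x powr p * \<eta> (F x / m R) powr \<theta>))"
        by (rule sum.inter_filter[OF finP, symmetric])
      also have "\<dots> = ennreal (F x powr p * (\<Sum>R\<in>{R\<in>P. x \<in> R}. \<eta> (F x / m R) powr \<theta>))"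
        by (subst sum_ennreal) (auto simp: sum_distrib_left)
      also have "\<dots> \<le> ennreal (F x powr p * D)"
        using overlap[of x] by (intro ennreal_leI mult_left_mono) auto
      also have "\<dots> = ennreal D * ennreal (F x powr p)"
        using D by (simp add: ennreal_mult' mult.commute)
      finally show "(\<Sum>R\<in>P. ennreal (F x powr p * \<eta> (F x / m R) powr \<theta>) * indicator R x)
          \<le> ennreal D * ennreal (F x powr p)" .
    qed
    also have "\<dots> = ennreal (D * N)"
      using D N by (simp add: nn_integral_cmult ennreal_mult')
    finally show ?thesis .
  qed
  have ZR: "Z R \<le> ennreal (D * N)" if "R \<in> P" for R
    using member_le_sum[of R P Z] that finP Zsum by (auto intro: order_trans)
  then have Zfin: "Z R = ennreal (enn2real (Z R))" if "R \<in> P" for R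
    using that by (metis ennreal_enn2real_if ennreal_neq_top neq_top_trans)
  \<comment> \<open>Bounding \<eta> by e + e^(1 - \<theta>) * \<eta>^\<theta> inside the test
    integral estimates \<open>X R\<close> for every e; optimising e produces N^(\<theta> -
    1).\<close>
  have Xle: "X R powr \<theta> \<le> 2 powr \<theta> * N powr (\<theta> - 1) * enn2real (Z R)" if R: "R \<in> P" for R
  proof (rule powr_le_of_parametric_bound)
    have mR: "0 < m R" and [measurable]: "R \<in> sets M"
      using R P m S by (auto intro: fmeasurableD)
    show "0 \<le> X R" by (simp add: X_def)
    show "enn2real (Z R) = 0" if "N = 0"
      using ZR[OF R] that by simp
    fix e :: real assume e: "0 < e"
    have "ennreal (X R) \<le> (\<integral>\<^sup>+ x\<in>R. ennreal (F x powr p * \<eta> (F x / m R)) \<partial>M)"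
      unfolding X_def using test R P by auto
    also have "\<dots> \<le> (\<integral>\<^sup>+ x. ennreal e * ennreal (F x powr p)
        + ennreal (e powr (1 - \<theta>)) * (ennreal (F x powr p * \<eta> (F x / m R) powr \<theta>) * indicator R x) \<partial>M)"
    proof (rule nn_integral_mono)
      fix x
      have "F x powr p * \<eta> (F x / m R)
          \<le> F x powr p * (e + e powr (1 - \<theta>) * \<eta> (F x / m R) powr \<theta>)"
        using powr_parametric_ge[OF \<eta>0 e \<theta>] by (intro mult_left_mono) auto
      then have "ennreal (F x powr p * \<eta> (F x / m R)) \<le> ennreal e * ennreal (F x powr p)
          + ennreal (e powr (1 - \<theta>)) * ennreal (F x powr p * \<eta> (F x / m R) powr \<theta>)"
        using e by (simp flip: ennreal_mult' ennreal_plus add: algebra_simps ennreal_leI)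
      then show "ennreal (F x powr p * \<eta> (F x / m R)) * indicator R x \<le> ennreal e * ennreal (F x powr p)
          + ennreal (e powr (1 - \<theta>)) * (ennreal (F x powr p * \<eta> (F x / m R) powr \<theta>) * indicator R x)"
        by (auto simp: indicator_def)
    qed
    also have "\<dots> = ennreal e * ennreal N + ennreal (e powr (1 - \<theta>)) * Z R"
      unfolding Z_def by (simp add: nn_integral_add nn_integral_cmult N)
    also have "\<dots> = ennreal (e * N + e powr (1 - \<theta>) * enn2real (Z R))"
      using e N by (subst Zfin[OF R]) (simp add: ennreal_mult')
    finally show "X R \<le> e * N + e powr (1 - \<theta>) * enn2real (Z R)"
      using e N by (subst (asm) ennreal_le_iff) auto
  qed (use N in auto)
  have Zsum': "(\<Sum>R\<in>P. enn2real (Z R)) \<le> D * N"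
  proof -
    have "ennreal (\<Sum>R\<in>P. enn2real (Z R)) = (\<Sum>R\<in>P. ennreal (enn2real (Z R)))"
      by (simp add: sum_ennreal)
    also have "\<dots> = (\<Sum>R\<in>P. Z R)"
      by (rule sum.cong[OF refl]) (simp flip: Zfin)
    finally show ?thesis using Zsum D N
      by (metis ennreal_le_iff mult_nonneg_nonneg)
  qed
  have "(\<Sum>Q\<in>S. X Q powr \<theta>) \<le> 2 powr (p * \<theta> + \<theta>) * (\<Sum>R\<in>P. 2 powr \<theta> * N powr (\<theta> - 1) * enn2real (Z R))"
    using reduce Xle by (meson mult_left_mono order_trans powr_ge_zero sum_mono)
  also have "\<dots> = 2 powr (p * \<theta> + \<theta>) * (2 powr \<theta> * N powr (\<theta> - 1) * (\<Sum>R\<in>P. enn2real (Z R)))"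
    by (simp add: sum_distrib_left)
  also have "\<dots> \<le> 2 powr (p * \<theta> + \<theta>) * (2 powr \<theta> * N powr (\<theta> - 1) * (D * N))"
    using Zsum' by (intro mult_left_mono) auto
  also have "\<dots> = 2 powr (p * \<theta> + 2 * \<theta>) * D * N powr \<theta>"
  proof -
    have "2 powr (p * \<theta> + 2 * \<theta>) = 2 powr (p * \<theta> + \<theta>) * 2 powr \<theta>"
      by (simp add: powr_add[symmetric] algebra_simps)
    moreover have "N powr \<theta> = N powr (\<theta> - 1) * N"
      using N(2) by (cases "N = 0") (auto simp: powr_diff)
    ultimately show ?thesis by (simp only: mult_ac)
  qed
  finally show ?thesis by (simp add: X_def)
qed

subsection \<open>Young functions and Luxemburg norms\<close>

lemma young_mono: "young \<Psi> \<Longrightarrow> 0 \<le> a \<Longrightarrow> a \<le> b \<Longrightarrow> \<Psi> a \<le> \<Psi> b"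
  by (cases "a = b") (auto simp: young_def strict_mono_on_def less_le)

lemma young_nonneg: "young \<Psi> \<Longrightarrow> 0 \<le> a \<Longrightarrow> 0 \<le> \<Psi> a"
  using young_mono[of \<Psi> 0 a] by (simp add: young_def)

lemma young_strict: "young \<Psi> \<Longrightarrow> 0 \<le> a \<Longrightarrow> a < b \<Longrightarrow> \<Psi> a < \<Psi> b"
  by (auto simp: young_def strict_mono_on_def)

lemma young_surj:
  assumes "young \<Psi>" "0 \<le> t"
  shows "\<exists>x\<ge>0. \<Psi> x = t"
proof -
  have "filterlim (\<lambda>t. \<Psi> t / t) at_top at_top"
    using assms by (simp add: young_def)
  then have "eventually (\<lambda>x. t \<le> \<Psi> x / x) at_top"
    by (simp add: filterlim_at_top)
  moreover have "eventually (\<lambda>x::real. 1 \<le> x) at_top"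
    by (rule eventually_ge_at_top)
  ultimately have "eventually (\<lambda>x. 1 \<le> x \<and> t \<le> \<Psi> x / x) at_top"
    by eventually_elim simp
  then obtain b where b: "1 \<le> b" "t \<le> \<Psi> b / b"
    by (auto simp: eventually_at_top_linorder)
  then have "t * b \<le> \<Psi> b" by (simp add: field_simps)
  moreover have "t * 1 \<le> t * b" using b assms by (intro mult_left_mono) auto
  ultimately have "t \<le> \<Psi> b" by simp
  moreover have "continuous_on {0..b} \<Psi>"
    using assms by (auto simp: young_def intro: continuous_on_subset)
  ultimately show ?thesis
    using IVT'[of \<Psi> 0 t b] assms b by (auto simp: young_def)
qed

lemma young_inv_props:
  assumes "young \<Psi>" "0 \<le> t"
  shows "0 \<le> young_inv \<Psi> t" "\<Psi> (young_inv \<Psi> t) = t"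
proof -
  have inj: "inj_on \<Psi> {0..}"
    using assms by (auto simp: young_def intro: strict_mono_on_imp_inj_on)
  obtain x where x: "0 \<le> x" "\<Psi> x = t"
    using young_surj[OF assms] by auto
  then have "young_inv \<Psi> t = x"
    using the_inv_into_f_f[OF inj, of x] by (simp add: young_inv_def)
  with x show "0 \<le> young_inv \<Psi> t" "\<Psi> (young_inv \<Psi> t) = t" by auto
qed

lemma le_young_inv:
  assumes "young \<Psi>" "0 \<le> a" "\<Psi> a \<le> t"
  shows "a \<le> young_inv \<Psi> t"
proof (rule ccontr)
  assume "\<not> a \<le> young_inv \<Psi> t"
  moreover have "0 \<le> t" using assms young_nonneg[of \<Psi> a] by simp
  ultimately show False
    using young_strict[OF assms(1), of "young_inv \<Psi> t" a] young_inv_props[OF assms(1), of t] assms by auto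
qed

text \<open>Pointwise form of the generalised Hoelder inequality. With t the larger of \<Psi> a and
  \<phi> b, both a and b are bounded by the inverses at t, whose product is t^(1/r).\<close>

lemma young_product:
  assumes \<phi>: "young \<phi>" and \<Psi>: "young \<Psi>"
    and inv: "\<forall>t>0. young_inv \<Psi> t = t powr (1 / r) / young_inv \<phi> t"
    and "0 < r" "0 \<le> a" "0 \<le> b"
  shows "(a * b) powr r \<le> \<Psi> a + \<phi> b"
proof -
  define t where "t = max (\<Psi> a) (\<phi> b)"
  have ab: "0 \<le> \<Psi> a" "0 \<le> \<phi> b"
    using assms young_nonneg by auto
  show ?thesis
  proof (cases "t = 0")
    \<comment> \<open>The relation between the inverses is available for positive t only; at t = 0
      strict monotonicity forces a = 0.\<close>
    case True
    then have "\<Psi> a = 0" using ab by (simp add: t_def max_def split: if_splits)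
    then have "a = 0"
      using young_strict[OF \<Psi>, of 0 a] \<open>0 \<le> a\<close> \<Psi> by (cases "a = 0") (auto simp: young_def)
    then show ?thesis using ab by simp
  next
    case False
    then have t: "0 < t" using ab by (auto simp: t_def)
    have y: "0 < young_inv \<phi> t"
      using young_inv_props[OF \<phi>, of t] t \<phi> by (auto simp: young_def less_le)
    have "(a * b) powr r \<le> (young_inv \<Psi> t * young_inv \<phi> t) powr r"
      using assms le_young_inv[OF \<Psi>, of a t] le_young_inv[OF \<phi>, of b t] young_inv_props[OF \<Psi>, of t] t
      by (intro powr_mono2 mult_mono mult_nonneg_nonneg) (auto simp: t_def)
    also have "\<dots> = t"
      using inv t y \<open>0 < r\<close> by (simp add: powr_powr)
    also have "\<dots> \<le> \<Psi> a + \<phi> b" using ab by (simp add: t_def)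
    finally show ?thesis .
  qed
qed

lemma measurable_young:
  assumes "young \<Psi>" and [measurable]: "F \<in> borel_measurable M" and "\<And>x. 0 \<le> F x"
  shows "(\<lambda>x. \<Psi> (F x)) \<in> borel_measurable M"
proof -
  have [measurable]: "(\<lambda>t. \<Psi> (max 0 t)) \<in> borel_measurable borel"
    using assms(1) by (intro borel_measurable_max_0) (simp add: young_def)
  have "(\<lambda>x. \<Psi> (F x)) = (\<lambda>x. \<Psi> (max 0 (F x)))"
    using assms(3) by (simp add: max_absorb2)
  then show ?thesis by simp
qed

lemma measurable_young_ext:
  assumes "young \<phi>" and [measurable]: "W \<in> borel_measurable M"
  shows "(\<lambda>x. young_ext \<phi> (W x)) \<in> borel_measurable M"
proof -
  have [measurable]: "(\<lambda>x. \<phi> (enn2real (W x))) \<in> borel_measurable M"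
    by (rule measurable_young[OF assms(1)]) auto
  show ?thesis
    unfolding young_ext_def by measurable
qed

section \<open>Averages over a set\<close>

lemma avg_mono: "(\<And>x. x \<in> Q \<Longrightarrow> F x \<le> G x) \<Longrightarrow> avg Q F \<le> avg Q G"
  unfolding avg_def by (intro mult_left_mono nn_integral_mono) (auto simp: indicator_def)

lemma avg_add:
  assumes [measurable]: "F \<in> borel_measurable lebesgue" "G \<in> borel_measurable lebesgue" "Q \<in> sets lebesgue"
  shows "avg Q (\<lambda>x. F x + G x) = avg Q F + avg Q G"
  unfolding avg_def by (simp add: distrib_right distrib_left nn_integral_add)

lemma avg_cmult:
  assumes [measurable]: "F \<in> borel_measurable lebesgue" "Q \<in> sets lebesgue"
  shows "avg Q (\<lambda>x. c * F x) = c * avg Q F"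
  unfolding avg_def by (simp add: mult.assoc nn_integral_cmult mult.left_commute)

lemma avg_const:
  assumes "Q \<in> lmeasurable" "0 < vol Q"
  shows "avg Q (\<lambda>x. c) = c"
proof -
  have "avg Q (\<lambda>x. c) = ennreal (1 / vol Q) * (c * ennreal (vol Q))"
    using assms unfolding avg_def
    by (subst nn_integral_cmult_indicator) (auto simp: emeasure_eq_measure2 fmeasurableD)
  also have "\<dots> = c * (ennreal (1 / vol Q) * ennreal (vol Q))"
    by (simp add: mult_ac)
  also have "ennreal (1 / vol Q) * ennreal (vol Q) = 1"
    using assms by (simp flip: ennreal_mult')
  finally show ?thesis by simp
qed

lemma nn_integral_eq_avg:
  assumes "0 < vol Q"
  shows "(\<integral>\<^sup>+ x\<in>Q. F x \<partial>lebesgue) = ennreal (vol Q) * avg Q F"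
proof -
  have "ennreal (vol Q) * avg Q F
      = (ennreal (vol Q) * ennreal (1 / vol Q)) * (\<integral>\<^sup>+ x\<in>Q. F x \<partial>lebesgue)"
    by (simp add: avg_def mult.assoc)
  also have "ennreal (vol Q) * ennreal (1 / vol Q) = 1"
    using assms by (simp flip: ennreal_mult')
  finally show ?thesis by simp
qed

text \<open>\<open>young_product\<close> at F / m and W / l is averaged over \<open>Q\<close>. Where
  \<open>W\<close> is infinite the integrand on the right is infinite too, so the bound on
  \<open>f\<close> is asked for only elsewhere.\<close>

lemma avg_powr_le:
  fixes f F :: "'a::euclidean_space \<Rightarrow> real" and W :: "'a \<Rightarrow> ennreal"
  assumes Y: "young \<phi>" "young \<Psi>" "\<forall>t>0. young_inv \<Psi> t = t powr (1 / r) / young_inv \<phi> t"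
    and r: "0 < r" and Q: "Q \<in> sets lebesgue"
    and [measurable]: "F \<in> borel_measurable lebesgue" "W \<in> borel_measurable lebesgue"
    and F0: "\<And>x. 0 \<le> F x" and ml: "0 < m" "0 < l" and K: "0 \<le> K"
    and avgF: "avg Q (\<lambda>x. ennreal (\<Psi> (F x / m))) \<le> ennreal K"
    and avgW: "avg Q (\<lambda>x. young_ext \<phi> (W x / ennreal l)) \<le> 1"
    and f: "\<And>x. x \<in> Q \<Longrightarrow> W x \<noteq> \<infinity> \<Longrightarrow> \<bar>f x\<bar> \<le> F x * enn2real (W x)"
  shows "avg Q (\<lambda>x. ennreal (\<bar>f x\<bar> powr r)) \<le> ennreal ((m * l) powr r * (K + 1))"
proof -
  have [measurable]: "(\<lambda>x. \<Psi> (F x / m)) \<in> borel_measurable lebesgue"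
    using F0 ml by (intro measurable_young[OF Y(2)]) auto
  have [measurable]: "(\<lambda>x. young_ext \<phi> (W x / ennreal l)) \<in> borel_measurable lebesgue"
    by (intro measurable_young_ext[OF Y(1)]) auto
  have "avg Q (\<lambda>x. ennreal (\<bar>f x\<bar> powr r))
      \<le> avg Q (\<lambda>x. ennreal ((m * l) powr r) * (ennreal (\<Psi> (F x / m)) + young_ext \<phi> (W x / ennreal l)))"
  proof (rule avg_mono)
    fix x assume x: "x \<in> Q"
    show "ennreal (\<bar>f x\<bar> powr r)
        \<le> ennreal ((m * l) powr r) * (ennreal (\<Psi> (F x / m)) + young_ext \<phi> (W x / ennreal l))"
    proof (cases "W x")
      case (real w)
      have Wl: "W x / ennreal l = ennreal (w / l)"
        using real ml by (simp add: divide_ennreal)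
      have nn: "0 \<le> \<Psi> (F x / m)" "0 \<le> \<phi> (w / l)"
        using real F0[of x] ml young_nonneg[OF Y(2), of "F x / m"] young_nonneg[OF Y(1), of "w / l"] by auto
      have "\<bar>f x\<bar> \<le> F x * w" using f[OF x] real by simp
      also have "\<dots> = m * l * (F x / m * (w / l))" using ml by simp
      finally have "\<bar>f x\<bar> powr r \<le> (m * l * (F x / m * (w / l))) powr r"
        using r by (intro powr_mono2) auto
      also have "\<dots> = (m * l) powr r * (F x / m * (w / l)) powr r"
        using ml F0[of x] real by (subst powr_mult) auto
      also have "\<dots> \<le> (m * l) powr r * (\<Psi> (F x / m) + \<phi> (w / l))"
        using ml F0[of x] real by (intro mult_left_mono young_product[OF Y r]) auto
      finally have "ennreal (\<bar>f x\<bar> powr r) \<le> ennreal ((m * l) powr r * (\<Psi> (F x / m) + \<phi> (w / l)))"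
        by (rule ennreal_leI)
      also have "\<dots> = ennreal ((m * l) powr r) * (ennreal (\<Psi> (F x / m)) + ennreal (\<phi> (w / l)))"
        using nn by (simp add: ennreal_mult')
      finally show ?thesis
        using real ml unfolding Wl by (simp add: young_ext_def)
    next
      case top
      then have "W x / ennreal l = \<infinity>"
        by (simp add: ennreal_top_divide)
      then show ?thesis
        using ml by (simp add: young_ext_def ennreal_mult_top)
    qed
  qed
  also have "\<dots> = ennreal ((m * l) powr r) *
      (avg Q (\<lambda>x. ennreal (\<Psi> (F x / m))) + avg Q (\<lambda>x. young_ext \<phi> (W x / ennreal l)))"
    using Q by (simp add: avg_cmult avg_add)
  also have "\<dots> \<le> ennreal ((m * l) powr r) * (ennreal K + 1)"
    using avgF avgW by (intro mult_left_mono add_mono) auto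
  also have "\<dots> = ennreal ((m * l) powr r * (K + 1))"
    using K by (simp add: ennreal_mult' ennreal_plus)
  finally show ?thesis .
qed

text \<open>The bound at each admissible \<open>l\<close> is linear in \<open>l\<close>, so the
  infimum over \<open>l\<close> may be taken. The scale \<open>m\<close> of \<open>F\<close> stays
  explicit, because the stopping argument works with a chosen scale rather than with the
  norm.\<close>

lemma avg_powr_le_lux:
  fixes f F :: "'a::euclidean_space \<Rightarrow> real" and W :: "'a \<Rightarrow> ennreal"
  assumes Y: "young \<phi>" "young \<Psi>" "\<forall>t>0. young_inv \<Psi> t = t powr (1 / r) / young_inv \<phi> t"
    and r: "0 < r" and Q: "Q \<in> sets lebesgue"
    and meas: "F \<in> borel_measurable lebesgue" "W \<in> borel_measurable lebesgue"
    and F0: "\<And>x. 0 \<le> F x" and m: "0 < m" and K: "0 \<le> K"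
    and avgF: "avg Q (\<lambda>x. ennreal (\<Psi> (F x / m))) \<le> ennreal K"
    and f: "\<And>x. x \<in> Q \<Longrightarrow> W x \<noteq> \<infinity> \<Longrightarrow> \<bar>f x\<bar> \<le> F x * enn2real (W x)"
  shows "enn_powr (avg Q (\<lambda>x. ennreal (\<bar>f x\<bar> powr r))) (1 / r)
    \<le> ennreal (m * (K + 1) powr (1 / r)) * lux \<phi> Q W"
proof -
  define X where "X = enn_powr (avg Q (\<lambda>x. ennreal (\<bar>f x\<bar> powr r))) (1 / r)"
  define k where "k = m * (K + 1) powr (1 / r)"
  have k: "0 < k" using m K by (simp add: k_def)
  have "X / ennreal k \<le> lux \<phi> Q W"
    unfolding lux_def
  proof (rule Inf_greatest, clarify)
    fix l :: real assume l: "0 < l" "avg Q (\<lambda>x. young_ext \<phi> (W x / ennreal l)) \<le> 1"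
    have "X \<le> enn_powr (ennreal ((m * l) powr r * (K + 1))) (1 / r)"
      unfolding X_def using r avg_powr_le[OF Y r Q meas F0 m l(1) K avgF l(2) f]
      by (intro enn_powr_mono) auto
    also have "\<dots> = ennreal (k * l)"
      using K m l r by (simp add: enn_powr_ennreal powr_mult powr_powr k_def mult_ac)
    also have "\<dots> = ennreal k * ennreal l"
      using k l by (simp add: ennreal_mult')
    finally show "X / ennreal k \<le> ennreal l"
      using k by (intro divide_le_posI_ennreal) auto
  qed
  then have "ennreal k * (X / ennreal k) \<le> ennreal k * lux \<phi> Q W"
    by (rule mult_left_mono) simp
  moreover have "ennreal k * (X / ennreal k) = X"
    using k ennreal_mult_divide_eq[of "ennreal k" X]
    by (simp add: ennreal_times_divide mult.commute[of "ennreal k"])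
  ultimately show ?thesis
    by (simp add: X_def k_def)
qed

text \<open>If the norm were 0, \<open>avg_powr_le_lux\<close> with \<open>F\<close> = 1 would make
  an r-mean over \<open>Q\<close> vanish. Replacing infinite values of \<open>W\<close> by 1 gives a
  real function that is still positive, so \<open>Q\<close> would be null.\<close>

lemma lux_pos:
  fixes W :: "'a::euclidean_space \<Rightarrow> ennreal"
  assumes Y: "young \<phi>" "young \<Psi>" "\<forall>t>0. young_inv \<Psi> t = t powr (1 / r) / young_inv \<phi> t"
    and r: "0 < r" and Q: "Q \<in> lmeasurable" "0 < vol Q"
    and meas [measurable]: "W \<in> borel_measurable lebesgue" and W: "\<And>x. 0 < W x"
  shows "0 < lux \<phi> Q W"
proof (rule ccontr)
  assume "\<not> 0 < lux \<phi> Q W"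
  then have 0: "lux \<phi> Q W = 0" by (simp add: zero_less_iff_neq_zero)
  define f where "f x = (if W x = \<infinity> then 1 else enn2real (W x))" for x
  have fpos: "0 < f x" for x
    using W[of x] by (cases "W x") (auto simp: f_def)
  have [measurable]: "f \<in> borel_measurable lebesgue"
    unfolding f_def by measurable
  have Qs [measurable]: "Q \<in> sets lebesgue" using Q by (auto simp: fmeasurableD)
  have "enn_powr (avg Q (\<lambda>x. ennreal (\<bar>f x\<bar> powr r))) (1 / r)
    \<le> ennreal (1 * (\<Psi> 1 + 1) powr (1 / r)) * lux \<phi> Q W"
  proof (rule avg_powr_le_lux[OF Y r, where F = "\<lambda>_. 1"])
    show "avg Q (\<lambda>x. ennreal (\<Psi> (1 / 1))) \<le> ennreal (\<Psi> 1)"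
      using avg_const[OF Q] by simp
  qed (use Q young_nonneg[OF Y(2), of 1] in \<open>auto simp: f_def fmeasurableD\<close>)
  then have "enn_powr (avg Q (\<lambda>x. ennreal (\<bar>f x\<bar> powr r))) (1 / r) = 0"
    by (simp add: 0)
  then have "avg Q (\<lambda>x. ennreal (\<bar>f x\<bar> powr r)) = 0"
    by (cases "avg Q (\<lambda>x. ennreal (\<bar>f x\<bar> powr r))") (auto simp: enn_powr_def)
  then have "(\<integral>\<^sup>+ x\<in>Q. ennreal (\<bar>f x\<bar> powr r) \<partial>lebesgue) = 0"
    by (simp add: nn_integral_eq_avg[OF Q(2)])
  then have "AE x in lebesgue. ennreal (\<bar>f x\<bar> powr r) * indicator Q x = 0"
    by (subst (asm) nn_integral_0_iff_AE) auto
  then have "AE x in lebesgue. x \<notin> Q"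
    by (rule AE_mp) (auto intro!: AE_I2 simp: indicator_def less_imp_neq[OF fpos, symmetric])
  then have "emeasure lebesgue Q = 0"
    using Qs by (metis AE_iff_null_sets null_setsD1)
  then show False using Q by (simp add: measure_def)
qed

text \<open>In the second alternative \<open>m\<close> is too small for the modular bound while 2 *
  m is admissible. The bound is 2 * \<Psi> c + 1 because arguments up to \<open>c\<close> contribute
  at most \<Psi> c to the average, so an inadmissible scale leaves more than 1 to the tail, which is
  the test inequality.\<close>

lemma exists_test_scale:
  fixes F :: "'a::euclidean_space \<Rightarrow> real"
  assumes Y: "young \<Psi>" and F [measurable]: "F \<in> borel_measurable lebesgue" and F0: "\<And>x. 0 \<le> F x"
    and p: "0 < p" and c: "0 < c"
    and N: "(\<integral>\<^sup>+ x. ennreal (F x powr p) \<partial>lebesgue) = ennreal N" "0 \<le> N"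
    and H: "0 \<le> H" "\<And>t. tail_ratio \<Psi> p c t \<le> H"
    and Q: "Q \<in> lmeasurable" "0 < vol Q"
  shows "(\<forall>l>0. avg Q (\<lambda>x. ennreal (\<Psi> (F x / l))) \<le> ennreal (2 * \<Psi> c + 1)) \<or>
    (\<exists>m>0. avg Q (\<lambda>x. ennreal (\<Psi> (F x / (2 * m)))) \<le> ennreal (2 * \<Psi> c + 1) \<and>
       ennreal (vol Q * m powr p) \<le> (\<integral>\<^sup>+ x\<in>Q. ennreal (F x powr p * tail_ratio \<Psi> p c (F x / m)) \<partial>lebesgue))"
proof -
  let ?\<eta> = "tail_ratio \<Psi> p c"
  let ?good = "\<lambda>l. avg Q (\<lambda>x. ennreal (\<Psi> (F x / l))) \<le> ennreal (2 * \<Psi> c + 1)"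
  have Qs [measurable]: "Q \<in> sets lebesgue" using Q by (auto simp: fmeasurableD)
  have \<eta>0: "0 \<le> ?\<eta> t" for t
    using young_nonneg[OF Y] c by (intro tail_ratio_nonneg) auto
  have [measurable]: "?\<eta> \<in> borel_measurable borel"
    using Y c by (intro borel_measurable_tail_ratio) (auto simp: young_def)
  have \<Psi>c: "0 \<le> \<Psi> c" using young_nonneg[OF Y] c by simp
  have test: "ennreal (vol Q * m powr p) \<le> (\<integral>\<^sup>+ x\<in>Q. ennreal (F x powr p * ?\<eta> (F x / m)) \<partial>lebesgue)"
    if m: "0 < m" and bad: "\<not> ?good m" for m
  proof -
    define B where "B = avg Q (\<lambda>x. ennreal (F x powr p * ?\<eta> (F x / m)))"
    have "avg Q (\<lambda>x. ennreal (\<Psi> (F x / m)))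
        \<le> avg Q (\<lambda>x. ennreal (\<Psi> c) + ennreal (m powr - p) * ennreal (F x powr p * ?\<eta> (F x / m)))"
    proof (rule avg_mono)
      fix x
      have "\<Psi> (F x / m) \<le> \<Psi> c + m powr - p * (F x powr p * ?\<eta> (F x / m))"
      proof (cases "c < F x / m")
        case True
        then have "0 < F x" using m c F0[of x] by (cases "F x = 0") (auto simp: less_le)
        then have "m powr - p * (F x powr p * ?\<eta> (F x / m)) = \<Psi> (F x / m)"
          using True m by (simp add: tail_ratio_def powr_divide powr_minus divide_simps)
        then show ?thesis using \<Psi>c by simp
      next
        case False
        then show ?thesis
          using young_mono[OF Y, of "F x / m" c] F0[of x] m by (simp add: tail_ratio_def)
      qed
      then have "ennreal (\<Psi> (F x / m)) \<le> ennreal (\<Psi> c + m powr - p * (F x powr p * ?\<eta> (F x / m)))"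
        by (rule ennreal_leI)
      also have "\<dots> = ennreal (\<Psi> c) + ennreal (m powr - p) * ennreal (F x powr p * ?\<eta> (F x / m))"
        using \<Psi>c \<eta>0 by (simp add: ennreal_mult')
      finally show "ennreal (\<Psi> (F x / m))
          \<le> ennreal (\<Psi> c) + ennreal (m powr - p) * ennreal (F x powr p * ?\<eta> (F x / m))" .
    qed
    also have "\<dots> = ennreal (\<Psi> c) + ennreal (m powr - p) * B"
      unfolding B_def using avg_const[OF Q] by (subst avg_add) (auto simp: avg_cmult)
    finally have le: "avg Q (\<lambda>x. ennreal (\<Psi> (F x / m))) \<le> ennreal (\<Psi> c) + ennreal (m powr - p) * B" .
    have "ennreal (vol Q * m powr p) \<le> ennreal (vol Q) * B"
    proof (cases B)
      case (real b)
      have "ennreal (2 * \<Psi> c + 1) < ennreal (\<Psi> c + m powr - p * b)"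
        using bad le real \<Psi>c by (simp add: ennreal_mult' not_le)
      then have "2 * \<Psi> c + 1 < \<Psi> c + m powr - p * b"
        using \<Psi>c by (subst (asm) ennreal_less_iff) auto
      then have "1 \<le> m powr - p * b" using \<Psi>c by simp
      then have "m powr p \<le> b" using m by (simp add: powr_minus field_simps)
      then have "vol Q * m powr p \<le> vol Q * b" by (intro mult_left_mono) auto
      then show ?thesis
        using real by (simp flip: ennreal_mult' add: ennreal_leI)
    next
      case top
      then show ?thesis using Q by (simp add: ennreal_mult_top)
    qed
    then show ?thesis
      by (simp add: nn_integral_eq_avg[OF Q(2)] B_def)
  qed
  have up: "?good l'" if "?good l" "0 < l" "l \<le> l'" for l l'
  proof -
    have "avg Q (\<lambda>x. ennreal (\<Psi> (F x / l'))) \<le> avg Q (\<lambda>x. ennreal (\<Psi> (F x / l)))"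
      using that F0 by (intro avg_mono ennreal_leI young_mono[OF Y] divide_left_mono) auto
    then show ?thesis using that(1) by (rule order_trans)
  qed
  have "\<exists>l>0. ?good l"
  proof (rule ccontr)
    assume none: "\<not> (\<exists>l>0. ?good l)"
    \<comment> \<open>At this scale the left side of the test inequality is H * N + 1, while the
      bound \<open>H\<close> on the tail ratio limits the right side to H * N.\<close>
    define l where "l = ((H * N + 1) / vol Q) powr (1 / p)"
    have pos: "0 < H * N + 1"
      by (intro add_nonneg_pos mult_nonneg_nonneg H N) simp
    then have l: "0 < l" using Q by (simp add: l_def)
    have "ennreal (vol Q * l powr p) \<le> (\<integral>\<^sup>+ x\<in>Q. ennreal (F x powr p * ?\<eta> (F x / l)) \<partial>lebesgue)"
      using test[OF l] none l by blast
    also have "\<dots> \<le> (\<integral>\<^sup>+ x. ennreal H * ennreal (F x powr p) \<partial>lebesgue)"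
    proof (rule nn_integral_mono)
      fix x
      have "F x powr p * ?\<eta> (F x / l) \<le> F x powr p * H"
        using H by (intro mult_left_mono) auto
      then show "ennreal (F x powr p * ?\<eta> (F x / l)) * indicator Q x \<le> ennreal H * ennreal (F x powr p)"
        using H by (auto simp: indicator_def ennreal_leI mult.commute simp flip: ennreal_mult')
    qed
    also have "\<dots> = ennreal (H * N)"
      using H N by (simp add: nn_integral_cmult ennreal_mult')
    finally have "vol Q * l powr p \<le> H * N"
      using H N by (subst (asm) ennreal_le_iff) auto
    moreover have "vol Q * l powr p = H * N + 1"
      using pos Q p by (simp add: l_def powr_powr)
    ultimately show False by simp
  qed
  then obtain l0 where l0: "0 < l0" "?good l0" by auto
  show ?thesis
  proof (cases "\<forall>l>0. ?good l")
    case False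
    then obtain l1 where l1: "0 < l1" "\<not> ?good l1" by auto
    obtain j :: nat where "l0 / l1 < 2 ^ j"
      using real_arch_pow[of 2 "l0 / l1"] by auto
    then have "l0 \<le> l1 * 2 ^ j" using l1 by (simp add: field_simps)
    then have ex: "?good (l1 * 2 ^ j)" using up l0 by blast
    \<comment> \<open>The first admissible doubling: \<open>k\<close> is positive because
      \<open>l1\<close> itself is inadmissible, so its predecessor fails and the double of that
      succeeds.\<close>
    define k where "k = (LEAST j. ?good (l1 * 2 ^ j))"
    have k: "?good (l1 * 2 ^ k)" unfolding k_def using ex by (rule LeastI)
    have "k \<noteq> 0" using k l1 by (metis mult.right_neutral power_0)
    then obtain i where i: "k = Suc i" by (cases k) auto
    have "\<not> ?good (l1 * 2 ^ i)"
      using not_less_Least[of i "\<lambda>j. ?good (l1 * 2 ^ j)"] i by (simp add: k_def)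
    then have "ennreal (vol Q * (l1 * 2 ^ i) powr p)
        \<le> (\<integral>\<^sup>+ x\<in>Q. ennreal (F x powr p * ?\<eta> (F x / (l1 * 2 ^ i))) \<partial>lebesgue)"
      using l1 by (intro test) auto
    moreover have "?good (2 * (l1 * 2 ^ i))"
      using k i by (simp add: mult.left_commute)
    ultimately show ?thesis
      using l1 by (intro disjI2 exI[of _ "l1 * 2 ^ i"]) auto
  qed auto
qed

section \<open>Control of one factor of the product\<close>

lemma measurable_neg_root:
  assumes [measurable]: "v \<in> borel_measurable M"
  shows "neg_root v p \<in> borel_measurable M"
  unfolding neg_root_def[abs_def] by measurable

lemma neg_root_pos: "(\<And>x. 0 \<le> v x) \<Longrightarrow> 0 < neg_root v p x"
  by (auto simp: neg_root_def)

text \<open>\<open>m\<close> below is comparable to the Luxemburg norm of \<open>\<bar>f\<bar> v\<^bsup>1/p\<^esup>\<close> over \<open>Q\<close> for the Young function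
  associated with \<open>\<phi>\<close>; \<open>\<eta>\<close> tests this norm from below.\<close>

locale orlicz_control =
  fixes r p \<theta> :: real and \<phi> :: "real \<Rightarrow> real" and v :: "'a::euclidean_space \<Rightarrow> real"
    and k D :: real and \<eta> :: "real \<Rightarrow> real"
  assumes exponents: "0 < r" "0 < p" "1 \<le> \<theta>"
    and measurable_v: "v \<in> borel_measurable lebesgue"
    and constants: "0 < k" "0 \<le> D"
    and \<eta>: "\<eta> \<in> borel_measurable borel" "\<And>t. 0 \<le> \<eta> t"
    and separated_sum: "\<And>s T. finite T \<Longrightarrow> 0 \<le> s \<Longrightarrow> (\<forall>a\<in>T. 0 < a) \<Longrightarrow>
        (\<forall>a\<in>T. \<forall>b\<in>T. a < b \<longrightarrow> 2 * a < b) \<Longrightarrow> (\<Sum>a\<in>T. \<eta> (s / a) powr \<theta>) \<le> D"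
    and lux_pos: "\<And>Q. Q \<in> lmeasurable \<Longrightarrow> 0 < vol Q \<Longrightarrow> 0 < lux \<phi> Q (neg_root v p)"
    and scale: "\<And>f N Q. f \<in> borel_measurable lebesgue \<Longrightarrow> 0 \<le> N \<Longrightarrow>
        (\<integral>\<^sup>+ x. ennreal ((\<bar>f x\<bar> * v x powr (1 / p)) powr p) \<partial>lebesgue) = ennreal N \<Longrightarrow>
        Q \<in> lmeasurable \<Longrightarrow> 0 < vol Q \<Longrightarrow> lux \<phi> Q (neg_root v p) < \<infinity> \<Longrightarrow>
        avg Q (\<lambda>x. ennreal (\<bar>f x\<bar> powr r)) < \<infinity> \<and>
        (avg Q (\<lambda>x. ennreal (\<bar>f x\<bar> powr r)) = 0 \<or>
         (\<exists>m>0. enn_powr (avg Q (\<lambda>x. ennreal (\<bar>f x\<bar> powr r))) (1 / r) \<le> ennreal (k * m) * lux \<phi> Q (neg_root v p) \<and>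
            ennreal (vol Q * m powr p)
              \<le> (\<integral>\<^sup>+ x\<in>Q. ennreal ((\<bar>f x\<bar> * v x powr (1 / p)) powr p * \<eta> (\<bar>f x\<bar> * v x powr (1 / p) / m)) \<partial>lebesgue)))"
begin

text \<open>One scale per set is fixed before any subfamily is chosen; the embedding then applies to
  every packed finite laminar subfamily. The nonvanishing averages rule out the degenerate
  alternative in \<open>scale\<close>.\<close>

lemma exists_scales:
  fixes f :: "'a \<Rightarrow> real"
  assumes f [measurable]: "f \<in> borel_measurable lebesgue" and N: "0 \<le> N"
      "(\<integral>\<^sup>+ x. ennreal ((\<bar>f x\<bar> * v x powr (1 / p)) powr p) \<partial>lebesgue) = ennreal N"
    and S: "\<And>Q. Q \<in> S \<Longrightarrow> Q \<in> lmeasurable" "\<And>Q. Q \<in> S \<Longrightarrow> 0 < vol Q"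
      "\<And>Q. Q \<in> S \<Longrightarrow> lux \<phi> Q (neg_root v p) < \<infinity>"
      "\<And>Q. Q \<in> S \<Longrightarrow> avg Q (\<lambda>x. ennreal (\<bar>f x\<bar> powr r)) \<noteq> 0"
  obtains m where "\<And>Q. Q \<in> S \<Longrightarrow> 0 < m Q"
    "\<And>Q. Q \<in> S \<Longrightarrow> enn_powr (avg Q (\<lambda>x. ennreal (\<bar>f x\<bar> powr r))) (1 / r)
       \<le> ennreal (k * m Q) * lux \<phi> Q (neg_root v p)"
    "\<And>P. P \<subseteq> S \<Longrightarrow> finite P \<Longrightarrow> laminar P \<Longrightarrow>
       (\<And>R. R \<in> P \<Longrightarrow> (\<Sum>Q\<in>{Q\<in>P. Q \<subseteq> R}. vol Q) \<le> 2 * vol R) \<Longrightarrow>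
       (\<Sum>Q\<in>P. (vol Q * m Q powr p) powr \<theta>) \<le> 2 powr (p * \<theta> + 2 * \<theta>) * D * N powr \<theta>"
proof -
  note [measurable] = measurable_v
  have "\<forall>Q\<in>S. \<exists>m>0. enn_powr (avg Q (\<lambda>x. ennreal (\<bar>f x\<bar> powr r))) (1 / r) \<le> ennreal (k * m) * lux \<phi> Q (neg_root v p) \<and>
      ennreal (vol Q * m powr p)
        \<le> (\<integral>\<^sup>+ x\<in>Q. ennreal ((\<bar>f x\<bar> * v x powr (1 / p)) powr p * \<eta> (\<bar>f x\<bar> * v x powr (1 / p) / m)) \<partial>lebesgue)"
    using scale[OF f N S(1,2,3)] S(4) by blast
  from bchoice[OF this] obtain m where m: "\<forall>Q\<in>S. 0 < m Q \<and>
      enn_powr (avg Q (\<lambda>x. ennreal (\<bar>f x\<bar> powr r))) (1 / r) \<le> ennreal (k * m Q) * lux \<phi> Q (neg_root v p) \<and>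
      ennreal (vol Q * m Q powr p)
        \<le> (\<integral>\<^sup>+ x\<in>Q. ennreal ((\<bar>f x\<bar> * v x powr (1 / p)) powr p * \<eta> (\<bar>f x\<bar> * v x powr (1 / p) / m Q)) \<partial>lebesgue)"
    by blast
  show thesis
  proof (rule that[of m])
    fix P assume P: "P \<subseteq> S" "finite P" "laminar P"
      "\<And>R. R \<in> P \<Longrightarrow> (\<Sum>Q\<in>{Q\<in>P. Q \<subseteq> R}. vol Q) \<le> 2 * vol R"
    show "(\<Sum>Q\<in>P. (vol Q * m Q powr p) powr \<theta>) \<le> 2 powr (p * \<theta> + 2 * \<theta>) * D * N powr \<theta>"
      by (rule carleson_embedding[OF P(2,3) _ P(4) _ _ \<eta> exponents(2,3) _ N(2,1) _ constants(2) separated_sum])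
        (use m P(1) S(1) in auto)
  qed (use m in auto)
qed

end

text \<open>The witness \<eta> is the tail ratio of the companion \<Psi> of \<phi>, whose
  \<open>B\<close> condition gives the lacunary bound \<open>D\<close>. The scale comes from
  \<open>exists_test_scale\<close> for |f| * v^(1/p), and \<open>avg_powr_le_lux\<close> pairs it
  with v^(-1/p).\<close>

lemma orlicz_control_exists:
  fixes v :: "'a::euclidean_space \<Rightarrow> real"
  assumes \<phi>: "\<phi> \<in> Y_class r (B_class p (p * \<theta>))" and \<theta>: "1 \<le> \<theta>" and p: "0 < p" and r: "0 < r"
    and v [measurable]: "v \<in> borel_measurable lebesgue" and v0: "\<And>x. 0 \<le> v x"
  shows "\<exists>k D \<eta>. orlicz_control r p \<theta> \<phi> v k D \<eta>"
proof -
  obtain \<Psi> where Y: "young \<phi>" "young \<Psi>" "\<forall>t>0. young_inv \<Psi> t = t powr (1 / r) / young_inv \<phi> t"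
    and B: "\<Psi> \<in> B_class p (p * \<theta>)"
    using \<phi> by (auto simp: Y_class_def)
  obtain c where c: "0 < c"
    and fin: "(\<integral>\<^sup>+ t\<in>{c..}. ennreal (\<Psi> t powr \<theta> * t powr (- (p * \<theta>) - 1)) \<partial>lborel) < \<infinity>"
    using B p by (auto simp: B_class_def)
  let ?\<eta> = "tail_ratio \<Psi> p c"
  have cont: "continuous_on {0..} \<Psi>" and mono: "mono_on {0..} \<Psi>" and \<Psi>0: "0 \<le> \<Psi> 0"
    using Y(2) young_mono[OF Y(2)] by (auto simp: young_def intro!: mono_onI)
  obtain D where D: "0 \<le> D" "\<And>s T. finite T \<Longrightarrow> 0 \<le> s \<Longrightarrow> (\<forall>a\<in>T. 0 < a) \<Longrightarrow>
        (\<forall>a\<in>T. \<forall>b\<in>T. a < b \<longrightarrow> 2 * a < b) \<Longrightarrow> (\<Sum>a\<in>T. ?\<eta> (s / a) powr \<theta>) \<le> D"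
    using tail_ratio_separated_sum[OF cont mono \<Psi>0 p c _ fin] \<theta> by auto
  have \<eta>0: "0 \<le> ?\<eta> t" for t
    using young_nonneg[OF Y(2)] c by (intro tail_ratio_nonneg) auto
  \<comment> \<open>A single point is a separated set, so \<open>D\<close> also bounds each value of
    \<eta>.\<close>
  have \<eta>H: "?\<eta> t \<le> D powr (1 / \<theta>)" for t
  proof (cases "0 \<le> t")
    case True
    have "?\<eta> t powr \<theta> \<le> D"
      using D(2)[of "{1}" t] True by simp
    then have "(?\<eta> t powr \<theta>) powr (1 / \<theta>) \<le> D powr (1 / \<theta>)"
      using \<theta> by (intro powr_mono2) auto
    then show ?thesis using \<theta> \<eta>0[of t] by (simp add: powr_powr)
  next
    case False
    then show ?thesis using c by (simp add: tail_ratio_def)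
  qed
  define K where "K = 2 * \<Psi> c + 1"
  have K: "0 \<le> K" using young_nonneg[OF Y(2), of c] c by (simp add: K_def)
  \<comment> \<open>The factor 2 appears because the admissible scale is 2 * m, whereas the test
    holds at m.\<close>
  define k where "k = 2 * (K + 1) powr (1 / r)"
  have k: "0 < k" using K by (simp add: k_def)
  let ?W = "neg_root v p"
  have W [measurable]: "?W \<in> borel_measurable lebesgue" by (rule measurable_neg_root) fact
  have main: "avg Q (\<lambda>x. ennreal (\<bar>f x\<bar> powr r)) < \<infinity> \<and>
        (avg Q (\<lambda>x. ennreal (\<bar>f x\<bar> powr r)) = 0 \<or>
         (\<exists>m>0. enn_powr (avg Q (\<lambda>x. ennreal (\<bar>f x\<bar> powr r))) (1 / r) \<le> ennreal (k * m) * lux \<phi> Q ?W \<and>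
            ennreal (vol Q * m powr p)
              \<le> (\<integral>\<^sup>+ x\<in>Q. ennreal ((\<bar>f x\<bar> * v x powr (1 / p)) powr p * ?\<eta> (\<bar>f x\<bar> * v x powr (1 / p) / m)) \<partial>lebesgue)))"
    if [measurable]: "f \<in> borel_measurable lebesgue" and N: "0 \<le> N"
        "(\<integral>\<^sup>+ x. ennreal ((\<bar>f x\<bar> * v x powr (1 / p)) powr p) \<partial>lebesgue) = ennreal N"
      and Q: "Q \<in> lmeasurable" "0 < vol Q" and lux: "lux \<phi> Q ?W < \<infinity>" for f N Q
  proof -
    define F where "F = (\<lambda>x. \<bar>f x\<bar> * v x powr (1 / p))"
    have F [measurable]: "F \<in> borel_measurable lebesgue" unfolding F_def by measurable
    have F0: "0 \<le> F x" for x by (simp add: F_def)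
    have NF: "(\<integral>\<^sup>+ x. ennreal (F x powr p) \<partial>lebesgue) = ennreal N"
      using N(2) by (simp add: F_def)
    define A where "A = avg Q (\<lambda>x. ennreal (\<bar>f x\<bar> powr r))"
    have bound: "enn_powr A (1 / r) \<le> ennreal (m * (K + 1) powr (1 / r)) * lux \<phi> Q ?W"
      if "0 < m" "avg Q (\<lambda>x. ennreal (\<Psi> (F x / m))) \<le> ennreal K" for m
      unfolding A_def
    proof (rule avg_powr_le_lux[OF Y r _ F W F0 that(1) K that(2)])
      show "Q \<in> sets lebesgue" using Q by (auto simp: fmeasurableD)
      fix x assume "?W x \<noteq> \<infinity>"
      then have "v x \<noteq> 0" by (auto simp: neg_root_def)
      then have "v x powr (1 / p) * v x powr (- 1 / p) = 1"
        using v0[of x] by (simp add: powr_add[symmetric])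
      then show "\<bar>f x\<bar> \<le> F x * enn2real (?W x)"
        using \<open>v x \<noteq> 0\<close> by (simp add: F_def neg_root_def mult.assoc)
    qed
    have Afin: "A < \<infinity>" if "enn_powr A (1 / r) \<le> ennreal b * lux \<phi> Q ?W" for b
    proof -
      have "ennreal b * lux \<phi> Q ?W < \<infinity>"
        using lux by (simp add: ennreal_mult_less_top)
      with that have "enn_powr A (1 / r) \<noteq> \<infinity>" by auto
      then show ?thesis by (cases A) (auto simp: enn_powr_def)
    qed
    obtain L where L: "lux \<phi> Q ?W = ennreal L" "0 \<le> L"
      using lux by (cases "lux \<phi> Q ?W") auto
    consider "\<forall>l>0. avg Q (\<lambda>x. ennreal (\<Psi> (F x / l))) \<le> ennreal K" |
      m where "m > 0" "avg Q (\<lambda>x. ennreal (\<Psi> (F x / (2 * m)))) \<le> ennreal K"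
       "ennreal (vol Q * m powr p) \<le> (\<integral>\<^sup>+ x\<in>Q. ennreal (F x powr p * ?\<eta> (F x / m)) \<partial>lebesgue)"
      using exists_test_scale[OF Y(2) F F0 p c NF N(1) _ \<eta>H Q] unfolding K_def by auto
    then show ?thesis
    proof cases
      case 1
      have "enn_powr A (1 / r) \<le> 0"
      proof (rule ennreal_le_epsilon)
        fix e :: real assume e: "0 < e"
        \<comment> \<open>All scales being admissible, Hoelder holds with the arbitrarily small
          scale e / d, so the mean is 0. The summand 1 keeps \<open>d\<close> positive when
          \<open>L\<close> is 0.\<close>
        define d where "d = (K + 1) powr (1 / r) * L + 1"
        have d: "0 < d" using L by (simp add: d_def add_nonneg_pos)
        have "enn_powr A (1 / r) \<le> ennreal (e / d * (K + 1) powr (1 / r)) * ennreal L"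
          unfolding L(1)[symmetric] using e d by (intro bound 1[rule_format]) (auto intro: divide_pos_pos)
        also have "\<dots> = ennreal (e / d * ((K + 1) powr (1 / r) * L))"
          using L e d by (simp flip: ennreal_mult')
        also have "\<dots> \<le> ennreal (e / d * d)"
          using e d by (intro ennreal_leI mult_left_mono) (auto simp: d_def)
        finally show "enn_powr A (1 / r) \<le> 0 + ennreal e" using d by simp
      qed
      then have "enn_powr A (1 / r) = 0" by simp
      then have "A = 0" by (cases A) (auto simp: enn_powr_def)
      then show ?thesis by (simp add: A_def)
    next
      case 2
      have b: "enn_powr A (1 / r) \<le> ennreal (k * m) * lux \<phi> Q ?W"
        using bound[of "2 * m"] 2 by (simp add: k_def mult_ac)
      then show ?thesis
        using Afin[OF b] 2 unfolding A_def F_def by blast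
    qed
  qed
  have pos: "0 < lux \<phi> Q ?W" if "Q \<in> lmeasurable" "0 < vol Q" for Q
    by (rule lux_pos[OF Y r that W]) (rule neg_root_pos, rule v0)
  have "?\<eta> \<in> borel_measurable borel"
    using cont c by (rule borel_measurable_tail_ratio)
  then have "orlicz_control r p \<theta> \<phi> v k D ?\<eta>"
    using r p \<theta> v k D \<eta>0 pos main by unfold_locales
  then show ?thesis by blast
qed

subsection \<open>Bounds over finite laminar families of cubes\<close>

text \<open>The term of a single cube in \<open>frac_max\<close>, separated out so that it can also
  be evaluated on half-open cubes.\<close>

definition piece :: "real \<Rightarrow> real \<Rightarrow> real \<Rightarrow> ('a::euclidean_space \<Rightarrow> real) \<Rightarrow> ('a \<Rightarrow> real) \<Rightarrow> 'a set \<Rightarrow> ennreal" where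
  "piece \<alpha> r s f g Q = ennreal (vol Q powr (\<alpha> / real DIM('a)))
        * enn_powr (avg Q (\<lambda>y. ennreal (\<bar>f y\<bar> powr r))) (1 / r)
        * enn_powr (avg Q (\<lambda>y. ennreal (\<bar>g y\<bar> powr s))) (1 / s)"

text \<open>Half-open cubes, which tile exactly, have the same averages as their closures.\<close>

definition near_cube :: "'a::euclidean_space set \<Rightarrow> bool" where
  "near_cube Q \<longleftrightarrow> Q \<in> lmeasurable \<and> 0 < vol Q \<and>
     (\<exists>Q'. is_cube Q' \<and> vol Q = vol Q' \<and> (\<forall>F. avg Q F = avg Q' F))"

text \<open>The quantities in the weight condition, Luxemburg norms included, depend on a set only
  through its volume and its averages.\<close>

lemma A_class_near_cube:
  fixes u v1 v2 :: "'a::euclidean_space \<Rightarrow> real"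
  assumes "(u, v1, v2) \<in> A_class \<alpha> p1 p2 q \<phi>1 \<phi>2"
  obtains A where "0 \<le> A" "\<And>Q. near_cube Q \<Longrightarrow>
    ennreal (vol Q powr (\<alpha> / real DIM('a) + 1 / q - 1 / (p1 * p2 / (p1 + p2))))
        * enn_powr (avg Q (\<lambda>x. ennreal (u x))) (1 / q)
        * lux \<phi>1 Q (neg_root v1 p1) * lux \<phi>2 Q (neg_root v2 p2) \<le> ennreal A"
proof -
  define X where "X = (\<lambda>Q. ennreal (vol Q powr (\<alpha> / real DIM('a) + 1 / q - 1 / (p1 * p2 / (p1 + p2))))
        * enn_powr (avg Q (\<lambda>x. ennreal (u x))) (1 / q)
        * lux \<phi>1 Q (neg_root v1 p1) * lux \<phi>2 Q (neg_root v2 p2))"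
  have fin: "(SUP Q \<in> {Q. is_cube Q}. X Q) < \<infinity>"
    using assms by (simp add: A_class_def X_def)
  define A where "A = enn2real (SUP Q \<in> {Q. is_cube Q}. X Q)"
  have A: "ennreal A = (SUP Q \<in> {Q. is_cube Q}. X Q)"
    using fin by (simp add: A_def)
  have "X Q \<le> ennreal A" if Q: "near_cube Q" for Q
  proof -
    obtain Q' where Q': "is_cube Q'" "vol Q = vol Q'" "\<forall>F. avg Q F = avg Q' F"
      using Q unfolding near_cube_def by blast
    then have "X Q = X Q'" by (simp add: X_def lux_def)
    also have "\<dots> \<le> ennreal A" unfolding A using Q'(1) by (intro SUP_upper) auto
    finally show ?thesis .
  qed
  then show thesis using that[of A] by (simp add: A_def X_def)
qed

section \<open>The estimate for one cube and its summation over a laminar family\<close>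

lemma ennreal_powr_add: "0 \<le> x \<Longrightarrow> ennreal (x powr a) * ennreal (x powr b) = ennreal (x powr (a + b))"
  by (simp add: powr_add ennreal_mult')

text \<open>The \<open>u\<close>-mass of \<open>Q\<close> is its volume times its
  \<open>u\<close>-average, so it can be moved under the power q. The two Hoelder bounds then leave
  the weight product times V^(1/p).\<close>

lemma piece_powr_weight_le:
  fixes u v1 v2 :: "'a::euclidean_space \<Rightarrow> real"
  assumes pos: "0 < p1" "0 < p2" "0 < q" and p: "p = p1 * p2 / (p1 + p2)"
    and A: "0 \<le> A" and k: "0 < k1" "0 < k2" and m: "0 < m1" "0 < m2" and Q: "0 < vol Q"
    and AQ: "ennreal (vol Q powr (\<alpha> / real DIM('a) + 1 / q - 1 / p))
        * enn_powr (avg Q (\<lambda>x. ennreal (u x))) (1 / q) * l1 * l2 \<le> ennreal A"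
    and f: "enn_powr (avg Q (\<lambda>x. ennreal (\<bar>f x\<bar> powr r))) (1 / r) \<le> ennreal (k1 * m1) * l1"
    and g: "enn_powr (avg Q (\<lambda>x. ennreal (\<bar>g x\<bar> powr s))) (1 / s) \<le> ennreal (k2 * m2) * l2"
  shows "enn_powr (piece \<alpha> r s f g Q) q * (\<integral>\<^sup>+ x\<in>Q. ennreal (u x) \<partial>lebesgue)
    \<le> ennreal ((k1 * k2 * A) powr q * (((vol Q * m1 powr p1) powr (q / p)) powr (p / p1)
                                   * ((vol Q * m2 powr p2) powr (q / p)) powr (p / p2)))"
proof -
  define U where "U = enn_powr (avg Q (\<lambda>x. ennreal (u x))) (1 / q)"
  define V where "V = vol Q"
  define n where "n = real DIM('a)"
  have V: "0 < V" using Q by (simp add: V_def)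
  have "avg Q (\<lambda>x. ennreal (u x)) = enn_powr U q"
    using pos by (simp add: U_def enn_powr_powr enn_powr_1)
  moreover have "ennreal V = enn_powr (ennreal (V powr (1 / q))) q"
    using pos V by (simp add: enn_powr_ennreal powr_powr)
  ultimately have "enn_powr (piece \<alpha> r s f g Q) q * (\<integral>\<^sup>+ x\<in>Q. ennreal (u x) \<partial>lebesgue)
      = enn_powr (piece \<alpha> r s f g Q * (ennreal (V powr (1 / q)) * U)) q"
    using Q by (simp add: nn_integral_eq_avg enn_powr_mult V_def[symmetric])
  also have "\<dots> \<le> enn_powr (ennreal (V powr (\<alpha> / n)) * (ennreal (k1 * m1) * l1)
        * (ennreal (k2 * m2) * l2) * (ennreal (V powr (1 / q)) * U)) q"
    unfolding piece_def V_def n_def using f g pos by (intro enn_powr_mono mult_mono) auto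
  also have "ennreal (V powr (\<alpha> / n)) * (ennreal (k1 * m1) * l1)
        * (ennreal (k2 * m2) * l2) * (ennreal (V powr (1 / q)) * U)
      = ennreal (k1 * m1) * ennreal (k2 * m2) * (ennreal (V powr (\<alpha> / n)) * ennreal (V powr (1 / q))) * (U * l1 * l2)"
    by (simp only: mult_ac)
  also have "ennreal (V powr (\<alpha> / n)) * ennreal (V powr (1 / q))
      = ennreal (V powr (1 / p)) * ennreal (V powr (\<alpha> / n + 1 / q - 1 / p))"
    using V by (simp add: ennreal_powr_add)
  also have "ennreal (k1 * m1) * ennreal (k2 * m2) * (ennreal (V powr (1 / p)) * ennreal (V powr (\<alpha> / n + 1 / q - 1 / p))) * (U * l1 * l2)
      = ennreal (k1 * m1) * ennreal (k2 * m2) * ennreal (V powr (1 / p)) * (ennreal (V powr (\<alpha> / n + 1 / q - 1 / p)) * U * l1 * l2)"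
    by (simp only: mult_ac)
  also have "enn_powr (ennreal (k1 * m1) * ennreal (k2 * m2) * ennreal (V powr (1 / p)) * (ennreal (V powr (\<alpha> / n + 1 / q - 1 / p)) * U * l1 * l2)) q
     \<le> enn_powr (ennreal (k1 * m1) * ennreal (k2 * m2) * ennreal (V powr (1 / p)) * ennreal A) q"
    using AQ pos unfolding U_def V_def n_def by (intro enn_powr_mono mult_left_mono) auto
  also have "ennreal (k1 * m1) * ennreal (k2 * m2) * ennreal (V powr (1 / p)) * ennreal A
      = ennreal (k1 * k2 * A * (m1 * m2 * V powr (1 / p)))"
    using k m A by (simp flip: ennreal_mult' add: mult_ac)
  also have "enn_powr (ennreal (k1 * k2 * A * (m1 * m2 * V powr (1 / p)))) q
      = ennreal ((k1 * k2 * A) powr q * (m1 powr q * m2 powr q * V powr (q / p)))"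
    using k m A by (simp add: enn_powr_ennreal powr_mult powr_powr)
  \<comment> \<open>p / p1 + p / p2 = 1 distributes the power of \<open>V\<close> over the two
    factors, in the form in which Hoelder for sums can separate them.\<close>
  also have "m1 powr q * m2 powr q * V powr (q / p)
      = ((V * m1 powr p1) powr (q / p)) powr (p / p1) * ((V * m2 powr p2) powr (q / p)) powr (p / p2)"
  proof -
    have p0: "0 < p" using pos by (simp add: p)
    have "q / p * (p / p1) + q / p * (p / p2) = q / p"
    proof -
      have "p / p1 + p / p2 = 1" using pos by (simp add: p divide_simps)
      then show ?thesis by (simp only: distrib_left[symmetric] mult_1_right)
    qed
    then have "V powr (q / p) = V powr (q / p * (p / p1)) * V powr (q / p * (p / p2))"
      by (simp add: powr_add[symmetric])
    moreover have "((V * m powr t) powr (q / p)) powr (p / t) = V powr (q / p * (p / t)) * m powr q"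
      if "0 < t" for m t
    proof -
      have "t * (q / p) * (p / t) = q" using that p0 by simp
      then show ?thesis by (simp only: powr_mult powr_powr)
    qed
    ultimately show ?thesis
      using pos by (simp only: mult_ac)
  qed
  finally show ?thesis by (simp add: V_def)
qed

text \<open>The constant is independent of the family, which allows a limit over growing grids. A
  stopping time on the pieces selects a packed subfamily dominating the supremum up to a factor; the
  one-cube estimate and two Carleson bounds are then combined by Hoelder for sums.\<close>

lemma finite_laminar_bound:
  fixes u v1 v2 :: "'a::euclidean_space \<Rightarrow> real"
  assumes \<alpha>: "0 \<le> \<alpha>" and r: "1 < r" "r < p1" and s: "1 < s" "s < p2"
    and p: "p = p1 * p2 / (p1 + p2)" and pq: "p \<le> q"
    and \<phi>1: "\<phi>1 \<in> Y_class r (B_class p1 (p1 * q / p))"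
    and \<phi>2: "\<phi>2 \<in> Y_class s (B_class p2 (p2 * q / p))"
    and uv: "(u, v1, v2) \<in> A_class \<alpha> p1 p2 q \<phi>1 \<phi>2"
  obtains C where "0 \<le> C" "\<And>S f g N1 N2. finite S \<Longrightarrow> laminar S \<Longrightarrow> (\<And>Q. Q \<in> S \<Longrightarrow> near_cube Q) \<Longrightarrow>
     f \<in> borel_measurable lebesgue \<Longrightarrow> g \<in> borel_measurable lebesgue \<Longrightarrow> 0 \<le> N1 \<Longrightarrow> 0 \<le> N2 \<Longrightarrow>
     (\<integral>\<^sup>+ x. ennreal ((\<bar>f x\<bar> * v1 x powr (1 / p1)) powr p1) \<partial>lebesgue) = ennreal N1 \<Longrightarrow>
     (\<integral>\<^sup>+ x. ennreal ((\<bar>g x\<bar> * v2 x powr (1 / p2)) powr p2) \<partial>lebesgue) = ennreal N2 \<Longrightarrow>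
     (\<integral>\<^sup>+ x. (SUP Q\<in>S. enn_powr (piece \<alpha> r s f g Q) q * indicator Q x) * ennreal (u x) \<partial>lebesgue)
       \<le> ennreal (C * (N1 powr (q / p1) * N2 powr (q / p2)))"
proof -
  define \<theta> where "\<theta> = q / p"
  have pos: "0 < p1" "0 < p2" "0 < r" "0 < s" using r s by auto
  have p0: "0 < p" using pos by (simp add: p)
  have q0: "0 < q" using p0 pq by simp
  have \<theta>: "1 \<le> \<theta>" using p0 pq by (simp add: \<theta>_def)
  have split1: "p / p1 + p / p2 = 1" using pos by (simp add: p divide_simps)
  have weights: "weight u" "weight v1" "weight v2" using uv by (auto simp: A_class_def)
  have v [measurable]: "u \<in> borel_measurable lebesgue" "v1 \<in> borel_measurable lebesgue" "v2 \<in> borel_measurable lebesgue"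
    and v0: "\<And>x. 0 \<le> u x" "\<And>x. 0 \<le> v1 x" "\<And>x. 0 \<le> v2 x"
    using weights by (auto simp: weight_def)
  have \<phi>1': "\<phi>1 \<in> Y_class r (B_class p1 (p1 * \<theta>))" and \<phi>2': "\<phi>2 \<in> Y_class s (B_class p2 (p2 * \<theta>))"
    using \<phi>1 \<phi>2 by (auto simp: \<theta>_def)
  obtain k1 D1 \<eta>1 where "orlicz_control r p1 \<theta> \<phi>1 v1 k1 D1 \<eta>1"
    using orlicz_control_exists[OF \<phi>1' \<theta> pos(1,3) v(2) v0(2)] by blast
  then interpret c1: orlicz_control r p1 \<theta> \<phi>1 v1 k1 D1 \<eta>1 .
  obtain k2 D2 \<eta>2 where "orlicz_control s p2 \<theta> \<phi>2 v2 k2 D2 \<eta>2"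
    using orlicz_control_exists[OF \<phi>2' \<theta> pos(2,4) v(3) v0(3)] by blast
  then interpret c2: orlicz_control s p2 \<theta> \<phi>2 v2 k2 D2 \<eta>2 .
  obtain A where A: "0 \<le> A" "\<And>Q. near_cube Q \<Longrightarrow>
    ennreal (vol Q powr (\<alpha> / real DIM('a) + 1 / q - 1 / p))
        * enn_powr (avg Q (\<lambda>x. ennreal (u x))) (1 / q)
        * lux \<phi>1 Q (neg_root v1 p1) * lux \<phi>2 Q (neg_root v2 p2) \<le> ennreal A"
    using A_class_near_cube[OF uv] unfolding p by blast
  define C1 where "C1 = 2 powr (p1 * \<theta> + 2 * \<theta>) * D1"
  define C2 where "C2 = 2 powr (p2 * \<theta> + 2 * \<theta>) * D2"
  \<comment> \<open>16^q is the loss from the stopping time, (k1 * k2 * A)^q comes from the one-cube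
    estimate, \<open>C1\<close> and \<open>C2\<close> from the Carleson embeddings.\<close>
  define C where "C = 16 powr q * ((k1 * k2 * A) powr q * (C1 powr (p / p1) * C2 powr (p / p2)))"
  have C12: "0 \<le> C1" "0 \<le> C2" using c1.constants c2.constants by (auto simp: C1_def C2_def)
  have main: "(\<integral>\<^sup>+ x. (SUP Q\<in>S. enn_powr (piece \<alpha> r s f g Q) q * indicator Q x) * ennreal (u x) \<partial>lebesgue)
       \<le> ennreal (C * (N1 powr (q / p1) * N2 powr (q / p2)))"
    if S: "finite S" "laminar S" "\<And>Q. Q \<in> S \<Longrightarrow> near_cube Q"
      and f [measurable]: "f \<in> borel_measurable lebesgue" and g [measurable]: "g \<in> borel_measurable lebesgue"
      and N0: "0 \<le> N1" "0 \<le> N2"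
      and N1: "(\<integral>\<^sup>+ x. ennreal ((\<bar>f x\<bar> * v1 x powr (1 / p1)) powr p1) \<partial>lebesgue) = ennreal N1"
      and N2: "(\<integral>\<^sup>+ x. ennreal ((\<bar>g x\<bar> * v2 x powr (1 / p2)) powr p2) \<partial>lebesgue) = ennreal N2"
    for S f g N1 N2
  proof -
    define fa where "fa = (\<lambda>Q. avg Q (\<lambda>x. ennreal (\<bar>f x\<bar> powr r)))"
    define ga where "ga = (\<lambda>Q. avg Q (\<lambda>x. ennreal (\<bar>g x\<bar> powr s)))"
    define l1 where "l1 = (\<lambda>Q. lux \<phi>1 Q (neg_root v1 p1))"
    define l2 where "l2 = (\<lambda>Q. lux \<phi>2 Q (neg_root v2 p2))"
    define ua where "ua = (\<lambda>Q. avg Q (\<lambda>x. ennreal (u x)))"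
    let ?a = "piece \<alpha> r s f g"
    have a_def: "?a Q = ennreal (vol Q powr (\<alpha> / real DIM('a))) * enn_powr (fa Q) (1 / r) * enn_powr (ga Q) (1 / s)" for Q
      by (simp add: piece_def fa_def ga_def)
    define S' where "S' = {Q\<in>S. ua Q \<noteq> 0 \<and> ?a Q \<noteq> 0}"
    have Q: "Q \<in> lmeasurable" "0 < vol Q" "Q \<in> sets lebesgue" if "Q \<in> S" for Q
      using S(3)[OF that] by (auto simp: near_cube_def fmeasurableD)
    \<comment> \<open>On \<open>S'\<close> all factors of the weight product are nonzero and the
      product is finite, so neither Luxemburg norm can be infinite.\<close>
    have lfin: "l1 Q < \<infinity>" "l2 Q < \<infinity>" if "Q \<in> S'" for Q
    proof -
      have QS: "Q \<in> S" and uaQ: "ua Q \<noteq> 0" using that by (auto simp: S'_def)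
      have "enn_powr (ua Q) (1 / q) \<noteq> 0"
        using uaQ by (cases "ua Q") (auto simp: enn_powr_def)
      moreover have "l1 Q \<noteq> 0" "l2 Q \<noteq> 0"
        using c1.lux_pos[OF Q(1,2)[OF QS]] c2.lux_pos[OF Q(1,2)[OF QS]] by (auto simp: l1_def l2_def)
      moreover have "ennreal (vol Q powr (\<alpha> / real DIM('a) + 1 / q - 1 / p)) \<noteq> 0"
        using Q(2)[OF QS] by simp
      moreover have "ennreal (vol Q powr (\<alpha> / real DIM('a) + 1 / q - 1 / p))
          * enn_powr (ua Q) (1 / q) * l1 Q * l2 Q \<noteq> top"
        using A(2)[OF S(3)[OF QS]] unfolding ua_def l1_def l2_def
        by (metis ennreal_neq_top neq_top_trans)
      ultimately show "l1 Q < \<infinity>" "l2 Q < \<infinity>"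
        unfolding infinity_ennreal_def less_top[symmetric] ennreal_mult_eq_top_iff mult_eq_0_iff
        by auto
    qed
    have nz: "fa Q \<noteq> 0" "ga Q \<noteq> 0" if "Q \<in> S'" for Q
      using that by (auto simp: S'_def a_def enn_powr_0)
    have fin: "fa Q < \<infinity>" "ga Q < \<infinity>" if "Q \<in> S'" for Q
      using c1.scale[OF f N0(1) N1 Q(1,2)[of Q]] c2.scale[OF g N0(2) N2 Q(1,2)[of Q]] lfin[OF that] that
      by (auto simp: fa_def ga_def l1_def l2_def S'_def)
    have S'Q: "Q \<in> lmeasurable" "0 < vol Q" if "Q \<in> S'" for Q
      using that Q by (auto simp: S'_def)
    obtain m1 where m1: "\<And>Q. Q \<in> S' \<Longrightarrow> 0 < m1 Q"
      "\<And>Q. Q \<in> S' \<Longrightarrow> enn_powr (fa Q) (1 / r) \<le> ennreal (k1 * m1 Q) * l1 Q"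
      "\<And>P. P \<subseteq> S' \<Longrightarrow> finite P \<Longrightarrow> laminar P \<Longrightarrow>
         (\<And>R. R \<in> P \<Longrightarrow> (\<Sum>Q\<in>{Q\<in>P. Q \<subseteq> R}. vol Q) \<le> 2 * vol R) \<Longrightarrow>
         (\<Sum>Q\<in>P. (vol Q * m1 Q powr p1) powr \<theta>) \<le> C1 * N1 powr \<theta>"
      using c1.exists_scales[OF f N0(1) N1 S'Q lfin(1)[unfolded l1_def] nz(1)[unfolded fa_def]]
      unfolding fa_def l1_def C1_def by blast
    obtain m2 where m2: "\<And>Q. Q \<in> S' \<Longrightarrow> 0 < m2 Q"
      "\<And>Q. Q \<in> S' \<Longrightarrow> enn_powr (ga Q) (1 / s) \<le> ennreal (k2 * m2 Q) * l2 Q"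
      "\<And>P. P \<subseteq> S' \<Longrightarrow> finite P \<Longrightarrow> laminar P \<Longrightarrow>
         (\<And>R. R \<in> P \<Longrightarrow> (\<Sum>Q\<in>{Q\<in>P. Q \<subseteq> R}. vol Q) \<le> 2 * vol R) \<Longrightarrow>
         (\<Sum>Q\<in>P. (vol Q * m2 Q powr p2) powr \<theta>) \<le> C2 * N2 powr \<theta>"
      using c2.exists_scales[OF g N0(2) N2 S'Q lfin(2)[unfolded l2_def] nz(2)[unfolded ga_def]]
      unfolding ga_def l2_def C2_def by blast
    define fr where "fr = (\<lambda>Q. enn2real (fa Q))"
    define gr where "gr = (\<lambda>Q. enn2real (ga Q))"
    define ar where "ar = (\<lambda>Q. vol Q powr (\<alpha> / real DIM('a)) * fr Q powr (1 / r) * gr Q powr (1 / s))"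
    have ar: "?a Q = ennreal (ar Q)" if "Q \<in> S'" for Q
    proof -
      have "fa Q \<noteq> \<infinity>" "ga Q \<noteq> \<infinity>"
        using fin[OF that] by auto
      then show ?thesis
        by (simp add: a_def ar_def enn_powr_def fr_def gr_def ennreal_mult')
    qed
    have finS': "finite S'" using S by (simp add: S'_def)
    \<comment> \<open>16 = 4 * 4 is chosen so that a jump of the piece forces a fourfold jump of the
      average of |f|^r or of |g|^s.\<close>
    obtain P where P: "P \<subseteq> S'" "\<forall>Q\<in>S'. \<exists>R\<in>P. Q \<subseteq> R \<and> ar Q \<le> 16 * ar R"
      "\<forall>Q\<in>P. \<forall>R\<in>P. Q \<subset> R \<longrightarrow> 16 * ar R < ar Q"
      using principal_subfamily[OF finS', of ar 16] by (auto simp: ar_def)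
    have PS: "P \<subseteq> S" using P(1) by (auto simp: S'_def)
    have finP: "finite P" using P(1) finS' by (rule finite_subset)
    have lamP: "laminar P" using S(2) PS by (rule laminar_subset)
    have fmP: "P \<subseteq> lmeasurable" using PS Q by auto
    \<comment> \<open>As measures, the two powers have these averages as their density quotients, to
      which \<open>sparse_packing\<close> applies.\<close>
    define M1 where "M1 = density lebesgue (\<lambda>x. ennreal (\<bar>f x\<bar> powr r))"
    define M2 where "M2 = density lebesgue (\<lambda>x. ennreal (\<bar>g x\<bar> powr s))"
    have setsM: "sets M1 = sets lebesgue" "sets M2 = sets lebesgue" by (auto simp: M1_def M2_def)
    have eM: "emeasure M1 Q = ennreal (vol Q * fr Q)" "emeasure M2 Q = ennreal (vol Q * gr Q)" if "Q \<in> P" for Q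
    proof -
      have q: "Q \<in> S'" "Q \<in> S" using that P(1) PS by auto
      have "avg Q (\<lambda>x. ennreal (\<bar>f x\<bar> powr r)) = ennreal (fr Q)" "avg Q (\<lambda>x. ennreal (\<bar>g x\<bar> powr s)) = ennreal (gr Q)"
        using fin[OF q(1)] by (auto simp: fr_def gr_def fa_def ga_def)
      then show "emeasure M1 Q = ennreal (vol Q * fr Q)" "emeasure M2 Q = ennreal (vol Q * gr Q)"
        using Q[OF q(2)]
        by (auto simp: M1_def M2_def emeasure_density nn_integral_eq_avg ennreal_mult')
    qed
    have packing: "(\<Sum>Q\<in>{Q\<in>P. Q \<subseteq> R}. vol Q) \<le> 2 * vol R" if "R \<in> P" for R
    proof (rule sparse_packing[OF finP lamP fmP _ _ setsM _ _ that])
      show "P \<subseteq> fmeasurable M1" "P \<subseteq> fmeasurable M2"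
        using eM PS Q(3) by (auto simp: fmeasurable_def setsM)
      show "0 < vol Q" if "Q \<in> P" for Q using that PS Q by auto
      fix Q R assume QR: "Q \<in> P" "R \<in> P" "Q \<subset> R"
      have mean: "measure M1 Q / vol Q = fr Q" "measure M2 Q / vol Q = gr Q" if "Q \<in> P" for Q
        using eM[OF that] Q(2)[of Q] that PS by (auto simp: measure_def fr_def gr_def)
      show "4 * (measure M1 R / vol R) < measure M1 Q / vol Q \<or> 4 * (measure M2 R / vol R) < measure M2 Q / vol Q"
      proof (rule ccontr)
        assume "\<not> ?thesis"
        then have le: "fr Q \<le> 4 * fr R" "gr Q \<le> 4 * gr R"
          using mean[OF QR(1)] mean[OF QR(2)] by auto
        \<comment> \<open>If neither average jumps, each root grows by at most the factor 4, while
          the volume power does not grow on passing to the smaller cube since \<alpha> \<ge> 0. So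
          the piece cannot jump by 16.\<close>
        have four: "4 powr (1 / t) \<le> (4::real)" if "1 < t" for t
          using powr_mono[of "1 / t" 1 "4::real"] that by simp
        have nn: "0 \<le> fr X" "0 \<le> gr X" for X by (auto simp: fr_def gr_def)
        have "fr Q powr (1 / r) \<le> (4 * fr R) powr (1 / r)"
          using le r nn by (intro powr_mono2) auto
        also have "\<dots> \<le> 4 * fr R powr (1 / r)"
          using four[OF r(1)] nn by (simp add: powr_mult mult_right_mono)
        finally have 1: "fr Q powr (1 / r) \<le> 4 * fr R powr (1 / r)" .
        have "gr Q powr (1 / s) \<le> (4 * gr R) powr (1 / s)"
          using le s nn by (intro powr_mono2) auto
        also have "\<dots> \<le> 4 * gr R powr (1 / s)"
          using four[OF s(1)] nn by (simp add: powr_mult mult_right_mono)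
        finally have 2: "gr Q powr (1 / s) \<le> 4 * gr R powr (1 / s)" .
        have "vol Q \<le> vol R"
          using QR PS Q by (intro measure_mono_fmeasurable) auto
        then have "vol Q powr (\<alpha> / real DIM('a)) \<le> vol R powr (\<alpha> / real DIM('a))"
          using \<alpha> by (intro powr_mono2) auto
        then have "ar Q \<le> vol R powr (\<alpha> / real DIM('a)) * (4 * fr R powr (1 / r)) * (4 * gr R powr (1 / s))"
          unfolding ar_def using 1 2 by (intro mult_mono) auto
        then have "ar Q \<le> 16 * ar R" by (simp add: ar_def)
        then show False using P(3) QR by force
      qed
    qed
    note sum1 = m1(3)[OF P(1) finP lamP packing] and sum2 = m2(3)[OF P(1) finP lamP packing]
    \<comment> \<open>Cubes with zero \<open>u\<close>-average were dropped from \<open>S'\<close>;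
      they contribute to the integral only on a null set.\<close>
    have null: "AE x in lebesgue. \<forall>Q\<in>S. ua Q = 0 \<longrightarrow> x \<in> Q \<longrightarrow> u x = 0"
    proof (subst AE_ball_countable)
      show "countable S" using S(1) by (rule countable_finite)
      show "\<forall>Q\<in>S. AE x in lebesgue. ua Q = 0 \<longrightarrow> x \<in> Q \<longrightarrow> u x = 0"
      proof
        fix Q' assume Q': "Q' \<in> S"
        have [measurable]: "Q' \<in> sets lebesgue" using Q(3)[OF Q'] .
        show "AE x in lebesgue. ua Q' = 0 \<longrightarrow> x \<in> Q' \<longrightarrow> u x = 0"
        proof (cases "ua Q' = 0")
          case True
          then have "(\<integral>\<^sup>+ x\<in>Q'. ennreal (u x) \<partial>lebesgue) = 0"
            using Q(2)[OF Q'] by (simp add: nn_integral_eq_avg ua_def)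
          then have "AE x in lebesgue. ennreal (u x) * indicator Q' x = 0"
            by (subst (asm) nn_integral_0_iff_AE) auto
          then show ?thesis
            by (rule AE_mp) (auto intro!: AE_I2 simp: indicator_def v0 antisym)
        qed simp
      qed
    qed
    have "(\<integral>\<^sup>+ x. (SUP Q\<in>S. enn_powr (?a Q) q * indicator Q x) * ennreal (u x) \<partial>lebesgue)
        \<le> (\<integral>\<^sup>+ x. (\<Sum>R\<in>P. ennreal (16 powr q) * enn_powr (?a R) q * (ennreal (u x) * indicator R x)) \<partial>lebesgue)"
    proof (rule nn_integral_mono_AE, rule AE_mp[OF null], rule AE_I2, rule impI)
      \<comment> \<open>Every contributing cube lies in a selected one with comparable piece, so the
        supremum is bounded by a sum over \<open>P\<close>.\<close>
      fix x assume x: "\<forall>Q\<in>S. ua Q = 0 \<longrightarrow> x \<in> Q \<longrightarrow> u x = 0"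
      have "(SUP Q\<in>S. enn_powr (?a Q) q * indicator Q x) * ennreal (u x)
          = (SUP Q\<in>S. enn_powr (?a Q) q * indicator Q x * ennreal (u x))"
        by (rule SUP_mult_right_ennreal)
      also have "\<dots> \<le> (\<Sum>R\<in>P. ennreal (16 powr q) * enn_powr (?a R) q * (ennreal (u x) * indicator R x))"
      proof (rule SUP_least)
        fix Q assume QS: "Q \<in> S"
        show "enn_powr (?a Q) q * indicator Q x * ennreal (u x)
          \<le> (\<Sum>R\<in>P. ennreal (16 powr q) * enn_powr (?a R) q * (ennreal (u x) * indicator R x))"
        proof (cases "x \<in> Q \<and> ua Q \<noteq> 0 \<and> ?a Q \<noteq> 0")
          case True
          then have "Q \<in> S'" using QS by (simp add: S'_def)
          then obtain R where R: "R \<in> P" "Q \<subseteq> R" "ar Q \<le> 16 * ar R" using P(2) by blast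
          have "ar R \<ge> 0" by (simp add: ar_def)
          then have "?a Q \<le> ennreal 16 * ?a R"
            using R P(1) \<open>Q \<in> S'\<close> by (auto simp: ar ennreal_leI simp flip: ennreal_mult' simp del: ennreal_numeral)
          then have "enn_powr (?a Q) q \<le> enn_powr (ennreal 16 * ?a R) q"
            using q0 by (intro enn_powr_mono) auto
          also have "\<dots> = ennreal (16 powr q) * enn_powr (?a R) q"
            by (subst enn_powr_mult, subst enn_powr_ennreal) auto
          finally have "enn_powr (?a Q) q * indicator Q x * ennreal (u x)
              \<le> ennreal (16 powr q) * enn_powr (?a R) q * (ennreal (u x) * indicator R x)"
            using True R(2) by (auto simp: indicator_def intro!: mult_right_mono)
          also have "\<dots> \<le> (\<Sum>R\<in>P. ennreal (16 powr q) * enn_powr (?a R) q * (ennreal (u x) * indicator R x))"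
            using R(1) finP by (intro member_le_sum) auto
          finally show ?thesis .
        next
          case False
          then have "enn_powr (?a Q) q * indicator Q x * ennreal (u x) = 0"
            using x QS by (auto simp: enn_powr_0)
          then show ?thesis by (simp only: zero_le)
        qed
      qed
      finally show "(SUP Q\<in>S. enn_powr (?a Q) q * indicator Q x) * ennreal (u x)
          \<le> (\<Sum>R\<in>P. ennreal (16 powr q) * enn_powr (?a R) q * (ennreal (u x) * indicator R x))" .
    qed
    also have "\<dots> = (\<Sum>R\<in>P. ennreal (16 powr q) * (enn_powr (?a R) q * (\<integral>\<^sup>+ x\<in>R. ennreal (u x) \<partial>lebesgue)))"
    proof -
      have [measurable]: "R \<in> sets lebesgue" if "R \<in> P" for R using that PS Q by auto
      show ?thesis
        by (subst nn_integral_sum) (auto simp: nn_integral_cmult mult.assoc intro!: sum.cong)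
    qed
    also have "\<dots> \<le> (\<Sum>R\<in>P. ennreal (16 powr q) * ennreal ((k1 * k2 * A) powr q *
        (((vol R * m1 R powr p1) powr \<theta>) powr (p / p1) * ((vol R * m2 R powr p2) powr \<theta>) powr (p / p2))))"
    proof (intro sum_mono mult_left_mono)
      fix R assume R: "R \<in> P"
      then have R': "R \<in> S" "R \<in> S'" using PS P(1) by auto
      show "enn_powr (?a R) q * (\<integral>\<^sup>+ x\<in>R. ennreal (u x) \<partial>lebesgue) \<le> ennreal ((k1 * k2 * A) powr q *
        (((vol R * m1 R powr p1) powr \<theta>) powr (p / p1) * ((vol R * m2 R powr p2) powr \<theta>) powr (p / p2)))"
        unfolding \<theta>_def
        using m1 m2 R'
        by (intro piece_powr_weight_le[OF pos(1,2) q0 p A(1) c1.constants(1) c2.constants(1) _ _ Q(2)[OF R'(1)] A(2)[OF S(3)[OF R'(1)]]])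
          (auto simp: fa_def ga_def l1_def l2_def)
    qed simp
    also have "\<dots> = ennreal (16 powr q * ((k1 * k2 * A) powr q *
        (\<Sum>R\<in>P. ((vol R * m1 R powr p1) powr \<theta>) powr (p / p1) * ((vol R * m2 R powr p2) powr \<theta>) powr (p / p2))))"
      by (simp add: sum_distrib_left sum_nonneg flip: ennreal_mult' sum_distrib_left)
    also have "\<dots> \<le> ennreal (C * (N1 powr (q / p1) * N2 powr (q / p2)))"
    proof (rule ennreal_leI)
      \<comment> \<open>Hoelder with the conjugate exponents p1 / p and p2 / p decouples the
        factors; the Carleson bounds contribute N1^(\<theta> * p / p1) = N1^(q / p1), and likewise
        for \<open>N2\<close>.\<close>
      have "(\<Sum>R\<in>P. ((vol R * m1 R powr p1) powr \<theta>) powr (p / p1) * ((vol R * m2 R powr p2) powr \<theta>) powr (p / p2))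
          \<le> (\<Sum>R\<in>P. (vol R * m1 R powr p1) powr \<theta>) powr (p / p1) * (\<Sum>R\<in>P. (vol R * m2 R powr p2) powr \<theta>) powr (p / p2)"
        using p0 pos split1 by (intro sum_powr_mult_le finP) auto
      also have "\<dots> \<le> (C1 * N1 powr \<theta>) powr (p / p1) * (C2 * N2 powr \<theta>) powr (p / p2)"
        using sum1 sum2 p0 pos by (intro mult_mono powr_mono2 sum_nonneg) auto
      also have "\<dots> = C1 powr (p / p1) * C2 powr (p / p2) * (N1 powr (q / p1) * N2 powr (q / p2))"
      proof -
        have "\<theta> * (p / p1) = q / p1" "\<theta> * (p / p2) = q / p2"
          using p0 by (auto simp: \<theta>_def)
        then show ?thesis
          by (simp only: powr_mult powr_powr mult_ac)
      qed
      finally have "16 powr q * ((k1 * k2 * A) powr q *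
        (\<Sum>R\<in>P. ((vol R * m1 R powr p1) powr \<theta>) powr (p / p1) * ((vol R * m2 R powr p2) powr \<theta>) powr (p / p2)))
        \<le> 16 powr q * ((k1 * k2 * A) powr q * (C1 powr (p / p1) * C2 powr (p / p2) * (N1 powr (q / p1) * N2 powr (q / p2))))"
        by (intro mult_left_mono) auto
      then show "16 powr q * ((k1 * k2 * A) powr q *
        (\<Sum>R\<in>P. ((vol R * m1 R powr p1) powr \<theta>) powr (p / p1) * ((vol R * m2 R powr p2) powr \<theta>) powr (p / p2)))
        \<le> C * (N1 powr (q / p1) * N2 powr (q / p2))"
        by (simp add: C_def mult.assoc)
    qed
    finally show ?thesis .
  qed
  have "0 \<le> C" by (simp add: C_def)
  then show thesis using main by (rule that)
qed

subsection \<open>Dyadic grids\<close>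

definition grid_cube :: "'a::euclidean_space \<Rightarrow> real \<Rightarrow> ('a \<Rightarrow> int) \<Rightarrow> 'a set" where
  "grid_cube t h k = {x. \<forall>b\<in>Basis. \<lfloor>(x - t) \<bullet> b / h\<rfloor> = k b}"

lemma vol_cube:
  fixes a :: "'a::euclidean_space"
  assumes "0 < h"
  shows "vol (cbox a (a + h *\<^sub>R One)) = h ^ DIM('a)"
proof -
  have "vol (cbox a (a + h *\<^sub>R One)) = measure lborel (cbox a (a + h *\<^sub>R One))"
    by (simp add: measure_completion)
  also have "\<dots> = (\<Prod>i\<in>Basis. (a + h *\<^sub>R One) \<bullet> i - a \<bullet> i)"
    using assms by (intro content_cbox) (auto simp: inner_add_left)
  also have "\<dots> = (\<Prod>i\<in>(Basis::'a set). h)"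
    by (intro prod.cong) (auto simp: inner_add_left)
  finally show ?thesis by simp
qed

lemma grid_cube_between:
  fixes t :: "'a::euclidean_space" and k :: "'a \<Rightarrow> int"
  assumes "0 < h"
  defines "a \<equiv> t + (\<Sum>b\<in>Basis. (h * real_of_int (k b)) *\<^sub>R b)"
  shows "box a (a + h *\<^sub>R One) \<subseteq> grid_cube t h k" "grid_cube t h k \<subseteq> cbox a (a + h *\<^sub>R One)"
proof -
  have a: "a \<bullet> b = t \<bullet> b + h * real_of_int (k b)" if "b \<in> Basis" for b
    using that by (simp add: a_def inner_add_left inner_sum_left inner_Basis if_distrib sum.delta cong: if_cong)
  have *: "\<lfloor>(x - t) \<bullet> b / h\<rfloor> = k b \<longleftrightarrow> a \<bullet> b \<le> x \<bullet> b \<and> x \<bullet> b < (a + h *\<^sub>R One) \<bullet> b" if "b \<in> Basis" for x b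
    using that assms(1) by (auto simp: floor_eq_iff inner_diff_left inner_add_left a field_simps)
  show "box a (a + h *\<^sub>R One) \<subseteq> grid_cube t h k"
    by (auto simp: grid_cube_def * mem_box intro: less_imp_le)
  show "grid_cube t h k \<subseteq> cbox a (a + h *\<^sub>R One)"
    by (fastforce simp: grid_cube_def * mem_box intro: less_imp_le)
qed

text \<open>A grid cube lies between the open and the closed box with the same corners, and these
  differ by a null frontier.\<close>

lemma near_cube_grid_cube:
  fixes t :: "'a::euclidean_space"
  assumes h: "0 < h"
  shows "near_cube (grid_cube t h k)" and vol_grid_cube: "vol (grid_cube t h k) = h ^ DIM('a)"
proof -
  define a where "a = t + (\<Sum>b\<in>Basis. (h * real_of_int (k b)) *\<^sub>R b)"
  define Q where "Q = grid_cube t h k"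
  define Q' where "Q' = cbox a (a + h *\<^sub>R One)"
  have sub: "box a (a + h *\<^sub>R One) \<subseteq> Q" "Q \<subseteq> Q'"
    unfolding a_def Q_def Q'_def by (rule grid_cube_between[OF h])+
  have neg: "negligible (Q' - Q)"
  proof (rule negligible_subset)
    show "negligible (Q' - box a (a + h *\<^sub>R One))"
      unfolding Q'_def by (rule negligible_frontier_interval)
    show "Q' - Q \<subseteq> Q' - box a (a + h *\<^sub>R One)" using sub by auto
  qed
  have Q's: "Q' \<in> sets lebesgue" by (simp add: Q'_def)
  have null: "Q' - Q \<in> null_sets lebesgue"
    using neg by (simp add: negligible_iff_null_sets)
  have "Q = Q' - (Q' - Q)" using sub by auto
  then have Qs: "Q \<in> sets lebesgue"
    using Q's null by (metis null_setsD2 sets.Diff)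
  have em: "emeasure lebesgue Q = emeasure lebesgue Q'"
    using null Q's Qs sub(2) by (metis Diff_partition emeasure_Un_null_set)
  have vol: "vol Q = vol Q'" using em by (simp add: measure_def)
  have avg: "avg Q F = avg Q' F" for F
    unfolding avg_def vol
    using null sub by (intro arg_cong2[where f = "(*)"] refl nn_integral_null_delta Qs Q's) (simp add: Diff_eq_empty_iff[THEN iffD2])
  have volQ': "vol Q' = h ^ DIM('a)" unfolding Q'_def by (rule vol_cube[OF h])
  show "vol (grid_cube t h k) = h ^ DIM('a)" using vol volQ' by (simp add: Q_def)
  have "emeasure lebesgue Q' < \<infinity>"
    unfolding Q'_def by (simp add: emeasure_lborel_cbox_eq)
  then have "Q \<in> lmeasurable" using Qs em by (simp add: fmeasurable_def)
  moreover have "is_cube Q'" using h by (auto simp: is_cube_def Q'_def)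
  ultimately show "near_cube (grid_cube t h k)"
    using h vol volQ' avg unfolding near_cube_def Q_def[symmetric] by auto
qed

text \<open>The floor of y / (h * 2^d) is the integer quotient of the floor of y / h by 2^d, so the
  coarse index is determined by the fine one.\<close>

lemma grid_cube_nested:
  assumes "x \<in> grid_cube t h k" "x \<in> grid_cube t (h * 2 ^ d) k'"
  shows "grid_cube t h k \<subseteq> grid_cube t (h * 2 ^ d) k'"
proof -
  have *: "\<lfloor>y / (h * 2 ^ d)\<rfloor> = \<lfloor>y / h\<rfloor> div 2 ^ d" for y :: real
    using floor_divide_real_eq_div[of "2 ^ d" "y / h"] by simp
  show ?thesis
    using assms by (auto simp: grid_cube_def *)
qed

text \<open>Meshes run from 2^N down to 2^(-N). The shift, by 2^N / 3 in the coordinates from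
  \<open>U\<close>, is 2^j / 3 meshes at level \<open>j\<close>, as the one-third trick requires; a
  common shift for all levels preserves nesting.\<close>

definition grid_family :: "nat \<Rightarrow> 'a::euclidean_space set \<Rightarrow> 'a set set" where
  "grid_family N U = (\<lambda>(j, k). grid_cube ((2 ^ N / 3) *\<^sub>R \<Sum>U) (2 ^ N / 2 ^ j) k) `
     ({..2 * N} \<times> (Basis \<rightarrow>\<^sub>E {- (16 ^ N)..16 ^ N}))"

lemma finite_grid_family: "finite (grid_family N U)"
  unfolding grid_family_def by (intro finite_imageI finite_cartesian_product finite_PiE) auto

lemma near_cube_grid_family: "Q \<in> grid_family N U \<Longrightarrow> near_cube Q"
  by (auto simp: grid_family_def intro!: near_cube_grid_cube)

lemma laminar_grid_family: "laminar (grid_family N U)"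
proof -
  define t :: 'a where "t = (2 ^ N / 3) *\<^sub>R \<Sum>U"
  have nest: "grid_cube t (2 ^ N / 2 ^ j) k \<inter> grid_cube t (2 ^ N / 2 ^ i) k' = {} \<or>
      grid_cube t (2 ^ N / 2 ^ j) k \<subseteq> grid_cube t (2 ^ N / 2 ^ i) k'" if "i \<le> j" for i j and k k' :: "'a \<Rightarrow> int"
  proof -
    have "2 ^ j = 2 ^ i * (2::real) ^ (j - i)" using that by (simp flip: power_add)
    then have "2 ^ N / 2 ^ i = 2 ^ N / 2 ^ j * (2::real) ^ (j - i)" by simp
    then show ?thesis
      using grid_cube_nested[of _ t "2 ^ N / 2 ^ j" k "j - i" k'] by (metis disjoint_iff)
  qed
  show ?thesis
    unfolding laminar_def grid_family_def t_def[symmetric]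
  proof (intro ballI)
    fix A B
    assume "A \<in> (\<lambda>(j, k). grid_cube t (2 ^ N / 2 ^ j) k) ` ({..2 * N} \<times> (Basis \<rightarrow>\<^sub>E {- (16 ^ N)..16 ^ N}))"
      "B \<in> (\<lambda>(j, k). grid_cube t (2 ^ N / 2 ^ j) k) ` ({..2 * N} \<times> (Basis \<rightarrow>\<^sub>E {- (16 ^ N)..16 ^ N}))"
    then obtain i k j k' where AB: "A = grid_cube t (2 ^ N / 2 ^ i) k" "B = grid_cube t (2 ^ N / 2 ^ j) k'"
      by (auto elim!: imageE)
    show "A \<inter> B = {} \<or> A \<subseteq> B \<or> B \<subseteq> A"
    proof (cases "i \<le> j")
      case True
      then show ?thesis using nest[of i j k' k] unfolding AB by blast
    next
      case False
      then show ?thesis using nest[of j i k k'] unfolding AB by fastforce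
    qed
  qed
qed

text \<open>The one-third trick: no power of two is divisible by three, so the two grids keep a distance of at least
  one third of the mesh at every scale.\<close>

lemma floor_const_or_shifted:
  fixes a d :: real
  assumes "0 \<le> d" "d < 1 / 3"
  shows "\<lfloor>a + d\<rfloor> = \<lfloor>a\<rfloor> \<or> \<lfloor>a + d - 2 ^ j / 3\<rfloor> = \<lfloor>a - 2 ^ j / 3\<rfloor>"
proof (rule ccontr)
  assume not: "\<not> ?thesis"
  \<comment> \<open>If both floors jumped, the integer m and the shifted integer n + 2^j / 3 would
    lie in the same interval (a, a + d], shorter than 1/3.\<close>
  define m n where "m = \<lfloor>a + d\<rfloor>" and "n = \<lfloor>a + d - 2 ^ j / 3\<rfloor>"
  have "\<lfloor>a\<rfloor> \<le> m" "\<lfloor>a - 2 ^ j / 3\<rfloor> \<le> n"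
    using assms by (auto simp: m_def n_def intro!: floor_mono)
  with not have "\<lfloor>a\<rfloor> < m" "\<lfloor>a - 2 ^ j / 3\<rfloor> < n" by (auto simp: m_def n_def)
  then have "a < real_of_int m" "a - 2 ^ j / 3 < real_of_int n"
    by (auto simp: floor_less_iff)
  moreover have "real_of_int m \<le> a + d" "real_of_int n \<le> a + d - 2 ^ j / 3"
    by (auto simp: m_def n_def)
  ultimately have "real_of_int m - real_of_int n - 2 ^ j / 3 < 1 / 3"
      "2 ^ j / 3 - (real_of_int m - real_of_int n) < 1 / 3"
    using assms by linarith+
  then have "real_of_int (3 * (m - n) - 2 ^ j) < 1" "real_of_int (2 ^ j - 3 * (m - n)) < 1"
    by (auto simp: field_simps)
  then have "3 * (m - n) = 2 ^ j" by linarith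
  then have "(3::int) dvd 2 ^ j" by (metis dvd_triv_left)
  then have "(3::int) dvd 2"
    using prime_dvd_power[of "3::int" 2 j] by simp
  then show False by simp
qed

text \<open>The interval (3 h, 6 h] contains 2^e with e the floor of log 2 (6 h). Writing e = N - j
  puts \<open>j\<close> in the required range once N \<ge> |e|.\<close>

lemma dyadic_scale:
  fixes h :: real
  assumes "0 < h"
  shows "eventually (\<lambda>N. \<exists>j\<le>2 * N. 3 * h < 2 ^ N / 2 ^ j \<and> 2 ^ N / 2 ^ j \<le> 6 * h) sequentially"
proof -
  define e where "e = \<lfloor>log 2 (6 * h)\<rfloor>"
  have "real_of_int e \<le> log 2 (6 * h)" "log 2 (6 * h) < real_of_int e + 1"
    by (auto simp: e_def)
  then have e: "2 powr e \<le> 6 * h" "6 * h < 2 powr (e + 1)"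
    using assms by (auto simp: le_log_iff log_less_iff)
  have "\<exists>j\<le>2 * N. 3 * h < 2 ^ N / 2 ^ j \<and> 2 ^ N / 2 ^ j \<le> 6 * h" if "nat \<bar>e\<bar> \<le> N" for N
  proof -
    define j where "j = nat (int N - e)"
    have j: "int j = int N - e" "j \<le> 2 * N" using that by (auto simp: j_def)
    have "2 ^ N / 2 ^ j = (2::real) powr (real N - real j)"
      by (simp add: powr_diff powr_realpow)
    also have "real N - real j = e" using j by linarith
    finally show ?thesis
      using e j(2) by (intro exI[of _ j]) (auto simp: powr_add)
  qed
  then show ?thesis
    unfolding eventually_sequentially by blast
qed

text \<open>The mesh exceeds three sides of \<open>Q\<close>, so in every coordinate the plain or
  the shifted grid does not cut \<open>Q\<close>. It is at most six sides, whence the factor 6^n.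
  Large \<open>N\<close> brings mesh and index into the ranges of the family.\<close>

lemma cube_in_grid_family:
  fixes Q :: "'a::euclidean_space set"
  assumes "is_cube Q"
  shows "eventually (\<lambda>N. \<exists>U\<subseteq>Basis. \<exists>R\<in>grid_family N U. Q \<subseteq> R \<and> vol R \<le> 6 ^ DIM('a) * vol Q) sequentially"
proof -
  obtain a h where h: "0 < h" and Q: "Q = cbox a (a + h *\<^sub>R One)"
    using assms by (auto simp: is_cube_def)
  obtain N0 :: nat where N0: "norm a < 2 ^ N0"
    using real_arch_pow[of 2 "norm a"] by auto
  have "eventually (\<lambda>N. max 1 N0 \<le> N) sequentially"
    by (rule eventually_ge_at_top)
  with dyadic_scale[OF h] show ?thesis
  proof eventually_elim
    case (elim N)
    then obtain j where j: "j \<le> 2 * N" "3 * h < 2 ^ N / 2 ^ j" "2 ^ N / 2 ^ j \<le> 6 * h" by auto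
    define H :: real where "H = 2 ^ N / 2 ^ j"
    have H: "0 < H" "3 * h < H" "H \<le> 6 * h" using j by (auto simp: H_def)
    \<comment> \<open>\<open>U\<close> collects the coordinates in which the unshifted grid
      separates the two ends of \<open>Q\<close>.\<close>
    define U where "U = {b\<in>Basis. \<lfloor>(a \<bullet> b + h) / H\<rfloor> \<noteq> \<lfloor>a \<bullet> b / H\<rfloor>}"
    define t where "t = (2 ^ N / 3) *\<^sub>R \<Sum>U"
    have t: "t \<bullet> b = (if b \<in> U then 2 ^ N / 3 else 0)" if "b \<in> Basis" for b
    proof -
      have "\<Sum>U \<bullet> b = (\<Sum>c\<in>U. if c = b then 1 else 0)"
        unfolding inner_sum_left using that by (intro sum.cong) (auto simp: U_def inner_Basis)
      also have "\<dots> = (if b \<in> U then 1 else 0)"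
        by (simp add: U_def)
      finally show ?thesis by (simp add: t_def)
    qed
    have same: "\<lfloor>(a \<bullet> b + h - t \<bullet> b) / H\<rfloor> = \<lfloor>(a \<bullet> b - t \<bullet> b) / H\<rfloor>" if b: "b \<in> Basis" for b
    proof (cases "b \<in> U")
      case False
      then show ?thesis using b t[OF b] by (auto simp: U_def)
    next
      case True
      have tH: "t \<bullet> b = H * (2 ^ j / 3)" using t[OF b] True by (simp add: H_def)
      have "\<lfloor>a \<bullet> b / H + h / H - 2 ^ j / 3\<rfloor> = \<lfloor>a \<bullet> b / H - 2 ^ j / 3\<rfloor>"
      proof -
        have "0 \<le> h / H" "h / H < 1 / 3" using H h by (auto simp: field_simps)
        from floor_const_or_shifted[OF this, of "a \<bullet> b / H" j] True show ?thesis
          unfolding U_def add_divide_distrib by blast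
      qed
      then show ?thesis
        using H unfolding tH by (simp add: diff_divide_distrib add_divide_distrib)
    qed
    define k where "k = restrict (\<lambda>b. \<lfloor>(a - t) \<bullet> b / H\<rfloor>) Basis"
    define R where "R = grid_cube t H k"
    have "Q \<subseteq> R"
    proof
      fix x assume "x \<in> Q"
      then have x: "a \<bullet> b \<le> x \<bullet> b" "x \<bullet> b \<le> a \<bullet> b + h" if "b \<in> Basis" for b
        using that by (auto simp: Q mem_box inner_add_left)
      have "\<lfloor>(x - t) \<bullet> b / H\<rfloor> = \<lfloor>(a - t) \<bullet> b / H\<rfloor>" if b: "b \<in> Basis" for b
      proof (rule antisym)
        have "\<lfloor>(x - t) \<bullet> b / H\<rfloor> \<le> \<lfloor>(a \<bullet> b + h - t \<bullet> b) / H\<rfloor>"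
          using x[OF b] H by (intro floor_mono divide_right_mono) (auto simp: inner_diff_left)
        then show "\<lfloor>(x - t) \<bullet> b / H\<rfloor> \<le> \<lfloor>(a - t) \<bullet> b / H\<rfloor>"
          using same[OF b] by (simp add: inner_diff_left)
        show "\<lfloor>(a - t) \<bullet> b / H\<rfloor> \<le> \<lfloor>(x - t) \<bullet> b / H\<rfloor>"
          using x[OF b] H by (intro floor_mono divide_right_mono) (auto simp: inner_diff_left)
      qed
      then show "x \<in> R" by (simp add: R_def grid_cube_def k_def)
    qed
    moreover have "R \<in> grid_family N U"
    proof -
      \<comment> \<open>The coordinates of a - t are at most 2 * 2^N in size and the mesh is at
        least 2^(-N), so the quotient is at most 2 * 4^N, below 16^N because N \<ge> 1.\<close>
      have "\<lfloor>(a - t) \<bullet> b / H\<rfloor> \<in> {- (16 ^ N)..16 ^ N}" if b: "b \<in> Basis" for b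
      proof -
        have "norm a \<le> 2 ^ N0" using N0 by simp
        also have "\<dots> \<le> 2 ^ N" using elim(2) by (intro power_increasing) auto
        finally have "\<bar>a \<bullet> b\<bar> \<le> 2 ^ N" using Basis_le_norm[OF b, of a] by linarith
        moreover have "0 \<le> t \<bullet> b" "t \<bullet> b \<le> 2 ^ N" using t[OF b] by auto
        ultimately have "\<bar>(a - t) \<bullet> b\<bar> \<le> 2 * 2 ^ N" by (simp add: inner_diff_left)
        moreover have "1 / H \<le> 2 ^ N"
        proof -
          have "(2::real) ^ j \<le> 2 ^ (2 * N)" using j(1) by (intro power_increasing) auto
          also have "\<dots> = 2 ^ N * 2 ^ N" by (simp flip: power_add add: mult_2)
          finally show ?thesis by (simp add: H_def field_simps)
        qed
        ultimately have "\<bar>(a - t) \<bullet> b\<bar> * (1 / H) \<le> 2 * 2 ^ N * 2 ^ N"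
          using H by (intro mult_mono) auto
        have "\<bar>(a - t) \<bullet> b / H\<bar> \<le> 2 * 4 ^ N"
        proof -
          have "(2::real) ^ N * 2 ^ N = 4 ^ N" by (simp flip: power_mult_distrib)
          with \<open>\<bar>(a - t) \<bullet> b\<bar> * (1 / H) \<le> 2 * 2 ^ N * 2 ^ N\<close> H show ?thesis
            by (simp add: abs_divide mult.assoc)
        qed
        moreover have "2 * 4 ^ N + 1 \<le> (16::real) ^ N"
        proof -
          have "(4::real) ^ 1 \<le> 4 ^ N" using elim(2) by (intro power_increasing) auto
          then have "4 * 4 ^ N \<le> (4::real) ^ N * 4 ^ N" by (intro mult_right_mono) auto
          also have "\<dots> = 16 ^ N" by (simp flip: power_mult_distrib)
          finally show ?thesis using \<open>4 ^ 1 \<le> 4 ^ N\<close> by simp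
        qed
        ultimately have "- (16 ^ N) \<le> (a - t) \<bullet> b / H" "(a - t) \<bullet> b / H < 16 ^ N"
          by linarith+
        then show ?thesis by (auto simp: le_floor_iff intro: less_imp_le simp: floor_le_iff add.commute)
      qed
      then have "k \<in> Basis \<rightarrow>\<^sub>E {- (16 ^ N)..16 ^ N}" by (auto simp: k_def)
      then show ?thesis
        unfolding grid_family_def R_def t_def H_def using j(1) by force
    qed
    moreover have "vol R \<le> 6 ^ DIM('a) * vol Q"
    proof -
      have "vol R = H ^ DIM('a)" unfolding R_def by (rule vol_grid_cube[OF H(1)])
      also have "\<dots> \<le> (6 * h) ^ DIM('a)" using H by (intro power_mono) auto
      also have "\<dots> = 6 ^ DIM('a) * vol Q"
        unfolding Q vol_cube[OF h] by (rule power_mult_distrib)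
      finally show ?thesis .
    qed
    moreover have "U \<subseteq> Basis" by (auto simp: U_def)
    ultimately show ?case by blast
  qed
qed

subsection \<open>The maximal function\<close>

text \<open>Passing to \<open>R\<close> loses at most the volume ratio \<kappa> in each average, and
  roots of \<kappa> \<ge> 1 are at most \<kappa>. The volume power only increases since \<alpha>
  \<ge> 0.\<close>

lemma piece_le_enlarged:
  fixes f g :: "'a::euclidean_space \<Rightarrow> real"
  assumes QR: "Q \<subseteq> R" "0 < vol Q" "vol R \<le> \<kappa> * vol Q" "vol Q \<le> vol R"
    and "1 \<le> \<kappa>" "0 \<le> \<alpha>" "1 < r" "1 < s"
  shows "piece \<alpha> r s f g Q \<le> ennreal (\<kappa> * \<kappa>) * piece \<alpha> r s f g R"
proof -
  have R: "0 < vol R" using QR by simp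
  have avg: "avg Q F \<le> ennreal \<kappa> * avg R F" for F
  proof -
    have "1 / vol Q \<le> \<kappa> * (1 / vol R)"
      using QR R by (simp add: field_simps)
    then have "ennreal (1 / vol Q) \<le> ennreal \<kappa> * ennreal (1 / vol R)"
      using \<open>1 \<le> \<kappa>\<close> by (simp add: ennreal_leI flip: ennreal_mult')
    moreover have "(\<integral>\<^sup>+ x\<in>Q. F x \<partial>lebesgue) \<le> (\<integral>\<^sup>+ x\<in>R. F x \<partial>lebesgue)"
      using QR by (intro nn_set_integral_set_mono) auto
    ultimately show ?thesis
      unfolding avg_def mult.assoc[symmetric] by (rule mult_mono) auto
  qed
  have pow: "enn_powr (avg Q F) (1 / t) \<le> ennreal \<kappa> * enn_powr (avg R F) (1 / t)" if "1 < t" for F t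
  proof -
    have "enn_powr (avg Q F) (1 / t) \<le> enn_powr (ennreal \<kappa> * avg R F) (1 / t)"
      using avg that by (intro enn_powr_mono) auto
    also have "\<dots> = ennreal (\<kappa> powr (1 / t)) * enn_powr (avg R F) (1 / t)"
      using \<open>1 \<le> \<kappa>\<close> by (simp add: enn_powr_mult enn_powr_ennreal)
    also have "\<dots> \<le> ennreal \<kappa> * enn_powr (avg R F) (1 / t)"
      using powr_mono[of "1 / t" 1 \<kappa>] \<open>1 \<le> \<kappa>\<close> that by (intro mult_right_mono ennreal_leI) auto
    finally show ?thesis .
  qed
  have "piece \<alpha> r s f g Q \<le> ennreal (vol R powr (\<alpha> / real DIM('a)))
      * (ennreal \<kappa> * enn_powr (avg R (\<lambda>y. ennreal (\<bar>f y\<bar> powr r))) (1 / r))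
      * (ennreal \<kappa> * enn_powr (avg R (\<lambda>y. ennreal (\<bar>g y\<bar> powr s))) (1 / s))"
    unfolding piece_def using assms
    by (intro mult_mono pow ennreal_leI powr_mono2) auto
  also have "\<dots> = ennreal \<kappa> * ennreal \<kappa> * piece \<alpha> r s f g R"
    unfolding piece_def by (simp only: mult_ac)
  finally show ?thesis
    using \<open>1 \<le> \<kappa>\<close> by (simp add: ennreal_mult')
qed

lemma enn_powr_SUP_le:
  assumes "0 < q"
  shows "enn_powr (SUP i\<in>I. F i) q \<le> (SUP i\<in>I. enn_powr (F i) q)"
proof -
  define B where "B = (SUP i\<in>I. enn_powr (F i) q)"
  have "F i \<le> enn_powr B (1 / q)" if "i \<in> I" for i
  proof -
    have "enn_powr (enn_powr (F i) q) (1 / q) \<le> enn_powr B (1 / q)"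
      unfolding B_def using that assms by (intro enn_powr_mono SUP_upper) auto
    then show ?thesis using assms by (simp add: enn_powr_powr enn_powr_1)
  qed
  then have "(SUP i\<in>I. F i) \<le> enn_powr B (1 / q)" by (rule SUP_least)
  then have "enn_powr (SUP i\<in>I. F i) q \<le> enn_powr (enn_powr B (1 / q)) q"
    using assms by (intro enn_powr_mono) auto
  then show ?thesis using assms by (simp add: enn_powr_powr enn_powr_1 B_def)
qed

section \<open>Domination by shifted grids and passage to the limit\<close>

lemma frac_max_eq_SUP_piece: "frac_max \<alpha> r s f g x = (SUP Q\<in>{Q. is_cube Q \<and> x \<in> Q}. piece \<alpha> r s f g Q)"
  by (simp add: frac_max_def piece_def)

text \<open>The sum over the shifts replaces a maximum and splits under the integral; the power q is
  already taken.\<close>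

definition grid_max where
  "grid_max \<alpha> r s q f g N x =
    (\<Sum>U\<in>Pow Basis. SUP R\<in>grid_family N U. enn_powr (piece \<alpha> r s f g R) q * indicator R x)"

lemma measurable_grid_max_summand:
  "(\<lambda>x. SUP R\<in>grid_family N U. enn_powr (piece \<alpha> r s f g R) q * indicator R x) \<in> borel_measurable lebesgue"
proof (rule borel_measurable_SUP)
  show "countable (grid_family N U)"
    by (intro countable_finite finite_grid_family)
  fix R :: "'a set" assume "R \<in> grid_family N U"
  then have [measurable]: "R \<in> sets lebesgue"
    using near_cube_grid_family[of R N U] by (auto simp: near_cube_def fmeasurableD)
  show "(\<lambda>x. enn_powr (piece \<alpha> r s f g R) q * indicator R x) \<in> borel_measurable lebesgue"
    by measurable
qed

text \<open>Each cube through \<open>x\<close> is caught for all large \<open>N\<close>, so its term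
  is eventually below the grid sum, and the supremum over cubes follows. The shifts change with
  \<open>N\<close>; the limit inferior is the form that Fatou's lemma takes.\<close>

lemma frac_max_le_liminf:
  fixes f g :: "'a::euclidean_space \<Rightarrow> real"
  assumes "0 \<le> \<alpha>" "1 < r" "1 < s" "0 < q"
  shows "enn_powr (frac_max \<alpha> r s f g x) q * w
    \<le> liminf (\<lambda>N. ennreal ((36 ^ DIM('a)) powr q) * (grid_max \<alpha> r s q f g N x * w))"
proof -
  have "enn_powr (frac_max \<alpha> r s f g x) q * w
      \<le> (SUP Q\<in>{Q. is_cube Q \<and> x \<in> Q}. enn_powr (piece \<alpha> r s f g Q) q) * w"
    unfolding frac_max_eq_SUP_piece using assms by (intro mult_right_mono enn_powr_SUP_le) auto
  also have "\<dots> = (SUP Q\<in>{Q. is_cube Q \<and> x \<in> Q}. enn_powr (piece \<alpha> r s f g Q) q * w)"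
    by (rule SUP_mult_right_ennreal)
  also have "\<dots> \<le> liminf (\<lambda>N. ennreal ((36 ^ DIM('a)) powr q) * (grid_max \<alpha> r s q f g N x * w))"
  proof (rule SUP_least)
    fix Q assume "Q \<in> {Q. is_cube Q \<and> x \<in> Q}"
    then have Q: "is_cube Q" "x \<in> Q" by auto
    have volQ: "0 < vol Q"
    proof -
      obtain a h where "0 < h" "Q = cbox a (a + h *\<^sub>R One)" using Q(1) by (auto simp: is_cube_def)
      then show ?thesis by (simp only: vol_cube zero_less_power)
    qed
    have Qm: "Q \<in> sets lebesgue" using Q(1) by (auto simp: is_cube_def)
    show "enn_powr (piece \<alpha> r s f g Q) q * w
        \<le> liminf (\<lambda>N. ennreal ((36 ^ DIM('a)) powr q) * (grid_max \<alpha> r s q f g N x * w))"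
    proof (rule Liminf_bounded, rule eventually_mono[OF cube_in_grid_family[OF Q(1)]])
      fix N assume "\<exists>U\<subseteq>Basis. \<exists>R\<in>grid_family N U. Q \<subseteq> R \<and> vol R \<le> 6 ^ DIM('a) * vol Q"
      then obtain U R where UR: "U \<subseteq> Basis" "R \<in> grid_family N U" "Q \<subseteq> R" "vol R \<le> 6 ^ DIM('a) * vol Q"
        by blast
      have "vol Q \<le> vol R"
        using near_cube_grid_family[OF UR(2)] UR(3) Qm
        by (intro measure_mono_fmeasurable) (auto simp: near_cube_def)
      then have "piece \<alpha> r s f g Q \<le> ennreal (6 ^ DIM('a) * 6 ^ DIM('a)) * piece \<alpha> r s f g R"
        using UR volQ assms by (intro piece_le_enlarged) auto
      also have "(6::real) ^ DIM('a) * 6 ^ DIM('a) = 36 ^ DIM('a)"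
        by (simp flip: power_mult_distrib)
      finally have "enn_powr (piece \<alpha> r s f g Q) q \<le> enn_powr (ennreal (36 ^ DIM('a)) * piece \<alpha> r s f g R) q"
        using assms by (intro enn_powr_mono) auto
      also have "\<dots> = ennreal ((36 ^ DIM('a)) powr q) * enn_powr (piece \<alpha> r s f g R) q"
        by (subst enn_powr_mult, subst enn_powr_ennreal) auto
      also have "enn_powr (piece \<alpha> r s f g R) q = enn_powr (piece \<alpha> r s f g R) q * indicator R x"
        using UR(3) Q(2) by auto
      also have "\<dots> \<le> (SUP R\<in>grid_family N U. enn_powr (piece \<alpha> r s f g R) q * indicator R x)"
        using UR(2) by (rule SUP_upper)
      also have "\<dots> \<le> grid_max \<alpha> r s q f g N x"
        unfolding grid_max_def
        by (rule member_le_sum[where f = "\<lambda>U. SUP R\<in>grid_family N U. enn_powr (piece \<alpha> r s f g R) q * indicator R x"])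
          (use UR(1) in auto)
      finally have "enn_powr (piece \<alpha> r s f g Q) q \<le> ennreal ((36 ^ DIM('a)) powr q) * grid_max \<alpha> r s q f g N x"
        by (simp add: mult_left_mono)
      then have "enn_powr (piece \<alpha> r s f g Q) q * w \<le> ennreal ((36 ^ DIM('a)) powr q) * grid_max \<alpha> r s q f g N x * w"
        by (rule mult_right_mono) simp
      then show "enn_powr (piece \<alpha> r s f g Q) q * w \<le> ennreal ((36 ^ DIM('a)) powr q) * (grid_max \<alpha> r s q f g N x * w)"
        by (simp add: mult.assoc)
    qed
  qed
  finally show ?thesis .
qed

text \<open>The weight moves into the function, |f|^p * v = (|f| * v^(1/p))^p, which gives the
  unweighted integral that the embedding uses.\<close>

lemma wnorm_finite_integral:
  fixes v f :: "'a::euclidean_space \<Rightarrow> real"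
  assumes "0 < p" "\<And>x. 0 \<le> v x" "wnorm v p (\<lambda>x. ennreal \<bar>f x\<bar>) < \<infinity>"
  obtains N where "0 \<le> N" "(\<integral>\<^sup>+ x. ennreal ((\<bar>f x\<bar> * v x powr (1 / p)) powr p) \<partial>lebesgue) = ennreal N"
    "wnorm v p (\<lambda>x. ennreal \<bar>f x\<bar>) = ennreal (N powr (1 / p))"
proof -
  define I where "I = (\<integral>\<^sup>+ x. enn_powr (ennreal \<bar>f x\<bar>) p * ennreal (v x) \<partial>lebesgue)"
  have I: "I = (\<integral>\<^sup>+ x. ennreal ((\<bar>f x\<bar> * v x powr (1 / p)) powr p) \<partial>lebesgue)"
    unfolding I_def using assms
    by (intro nn_integral_cong) (simp add: enn_powr_ennreal powr_mult powr_powr ennreal_mult')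
  have w: "wnorm v p (\<lambda>x. ennreal \<bar>f x\<bar>) = enn_powr I (1 / p)"
    by (simp add: wnorm_def I_def)
  with assms(3) have "I \<noteq> \<infinity>" by (auto simp: enn_powr_def)
  then have fin: "I = ennreal (enn2real I)" by (simp add: less_top)
  have root: "enn_powr I (1 / p) = ennreal (enn2real I powr (1 / p))"
    using \<open>I \<noteq> \<infinity>\<close> by (simp add: enn_powr_def)
  show thesis
    by (rule that[OF _ I[symmetric, THEN trans, OF fin] w[THEN trans, OF root]]) simp
qed

theorem theorem6p2:
  fixes \<alpha> r s p1 p2 p q :: real
    and u v1 v2 :: "'a::euclidean_space \<Rightarrow> real"
    and \<phi>1 \<phi>2 :: "real \<Rightarrow> real"
  assumes "0 \<le> \<alpha>" "\<alpha> < real DIM('a)"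
    and "1 < r" "r < p1" "1 < s" "s < p2"
    and "p = p1 * p2 / (p1 + p2)" "r * s / (r + s) < p" "p \<le> q"
    and "\<phi>1 \<in> Y_class r (B_class p1 (p1 * q / p))"
    and "\<phi>2 \<in> Y_class s (B_class p2 (p2 * q / p))"
    and "(u, v1, v2) \<in> A_class \<alpha> p1 p2 q \<phi>1 \<phi>2"
  shows "\<exists>C::real. C > 0 \<and>
    (\<forall>f g. f \<in> borel_measurable lebesgue \<longrightarrow> g \<in> borel_measurable lebesgue \<longrightarrow>
       wnorm v1 p1 (\<lambda>x. ennreal \<bar>f x\<bar>) < \<infinity> \<longrightarrow> wnorm v2 p2 (\<lambda>x. ennreal \<bar>g x\<bar>) < \<infinity> \<longrightarrow>
       wnorm u q (frac_max \<alpha> r s f g)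
         \<le> ennreal C * wnorm v1 p1 (\<lambda>x. ennreal \<bar>f x\<bar>) * wnorm v2 p2 (\<lambda>x. ennreal \<bar>g x\<bar>))"
proof -
  obtain C0 where C0: "0 \<le> C0" "\<And>S f g N1 N2. finite S \<Longrightarrow> laminar S \<Longrightarrow> (\<And>Q. Q \<in> S \<Longrightarrow> near_cube Q) \<Longrightarrow>
     f \<in> borel_measurable lebesgue \<Longrightarrow> g \<in> borel_measurable lebesgue \<Longrightarrow> 0 \<le> N1 \<Longrightarrow> 0 \<le> N2 \<Longrightarrow>
     (\<integral>\<^sup>+ x. ennreal ((\<bar>f x\<bar> * v1 x powr (1 / p1)) powr p1) \<partial>lebesgue) = ennreal N1 \<Longrightarrow>
     (\<integral>\<^sup>+ x. ennreal ((\<bar>g x\<bar> * v2 x powr (1 / p2)) powr p2) \<partial>lebesgue) = ennreal N2 \<Longrightarrow>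
     (\<integral>\<^sup>+ x. (SUP Q\<in>S. enn_powr (piece \<alpha> r s f g Q) q * indicator Q x) * ennreal (u x) \<partial>lebesgue)
       \<le> ennreal (C0 * (N1 powr (q / p1) * N2 powr (q / p2)))"
    using finite_laminar_bound[OF assms(1,3-7,9-12)] by blast
  have pos: "0 < p1" "0 < p2" using assms by auto
  then have "0 < p" using assms by simp
  then have q: "0 < q" using assms(9) by simp
  have [measurable]: "u \<in> borel_measurable lebesgue" and v0: "\<And>x. 0 \<le> v1 x" "\<And>x. 0 \<le> v2 x"
    using assms(12) by (auto simp: A_class_def weight_def)
  define K :: real where "K = (36 ^ DIM('a)) powr q"
  have K: "0 \<le> K" by (simp add: K_def)
  \<comment> \<open>There are 2^n shifts \<open>U\<close>, each contributing \<open>C0\<close>;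
    \<open>K\<close> is the loss from enlarging cubes.\<close>
  define C1 where "C1 = K * (2 ^ DIM('a) * C0)"
  have C1: "0 \<le> C1" using K C0(1) by (simp add: C1_def)
  \<comment> \<open>The added 1 makes the constant positive even when \<open>C1\<close> is
    0.\<close>
  define C where "C = C1 powr (1 / q) + 1"
  have "wnorm u q (frac_max \<alpha> r s f g)
         \<le> ennreal C * wnorm v1 p1 (\<lambda>x. ennreal \<bar>f x\<bar>) * wnorm v2 p2 (\<lambda>x. ennreal \<bar>g x\<bar>)"
    if f: "f \<in> borel_measurable lebesgue" and g: "g \<in> borel_measurable lebesgue"
      and fin: "wnorm v1 p1 (\<lambda>x. ennreal \<bar>f x\<bar>) < \<infinity>" "wnorm v2 p2 (\<lambda>x. ennreal \<bar>g x\<bar>) < \<infinity>" for f g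
  proof -
    obtain N1 where N1: "0 \<le> N1" "(\<integral>\<^sup>+ x. ennreal ((\<bar>f x\<bar> * v1 x powr (1 / p1)) powr p1) \<partial>lebesgue) = ennreal N1"
      "wnorm v1 p1 (\<lambda>x. ennreal \<bar>f x\<bar>) = ennreal (N1 powr (1 / p1))"
      using wnorm_finite_integral[OF pos(1) v0(1) fin(1)] by blast
    obtain N2 where N2: "0 \<le> N2" "(\<integral>\<^sup>+ x. ennreal ((\<bar>g x\<bar> * v2 x powr (1 / p2)) powr p2) \<partial>lebesgue) = ennreal N2"
      "wnorm v2 p2 (\<lambda>x. ennreal \<bar>g x\<bar>) = ennreal (N2 powr (1 / p2))"
      using wnorm_finite_integral[OF pos(2) v0(2) fin(2)] by blast
    define B where "B = N1 powr (q / p1) * N2 powr (q / p2)"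
    have B: "0 \<le> B" by (simp add: B_def)
    note meas [measurable] = measurable_grid_max_summand[where \<alpha> = \<alpha> and r = r and s = s and f = f and g = g and q = q]
    have int: "(\<integral>\<^sup>+ x. ennreal K * (grid_max \<alpha> r s q f g N x * ennreal (u x)) \<partial>lebesgue) \<le> ennreal (C1 * B)" for N
    proof -
      have "(\<integral>\<^sup>+ x. ennreal K * (grid_max \<alpha> r s q f g N x * ennreal (u x)) \<partial>lebesgue)
          = ennreal K * (\<Sum>U\<in>Pow Basis. \<integral>\<^sup>+ x. (SUP R\<in>grid_family N U.
              enn_powr (piece \<alpha> r s f g R) q * indicator R x) * ennreal (u x) \<partial>lebesgue)"
        unfolding grid_max_def sum_distrib_right
        by (subst nn_integral_cmult, measurable, subst nn_integral_sum, measurable)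
      also have "\<dots> \<le> ennreal K * (\<Sum>U\<in>Pow (Basis :: 'a set). ennreal (C0 * B))"
        unfolding B_def
        by (intro mult_left_mono sum_mono C0(2) finite_grid_family laminar_grid_family
            near_cube_grid_family f g N1 N2) auto
      also have "\<dots> = ennreal (C1 * B)"
        using K C0(1) B
        by (simp add: C1_def card_Pow ennreal_mult' ennreal_power[symmetric] mult.assoc flip: ennreal_numeral)
      finally show ?thesis .
    qed
    have "(\<integral>\<^sup>+ x. enn_powr (frac_max \<alpha> r s f g x) q * ennreal (u x) \<partial>lebesgue)
        \<le> (\<integral>\<^sup>+ x. liminf (\<lambda>N. ennreal K * (grid_max \<alpha> r s q f g N x * ennreal (u x))) \<partial>lebesgue)"
      unfolding K_def using assms q by (intro nn_integral_mono frac_max_le_liminf) auto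
    \<comment> \<open>Fatou's lemma; the bound \<open>int\<close> on the integrals is uniform in
      \<open>N\<close>.\<close>
    also have "\<dots> \<le> liminf (\<lambda>N. \<integral>\<^sup>+ x. ennreal K * (grid_max \<alpha> r s q f g N x * ennreal (u x)) \<partial>lebesgue)"
      by (rule nn_integral_liminf) (unfold grid_max_def, measurable)
    also have "\<dots> \<le> liminf (\<lambda>N::nat. ennreal (C1 * B))"
      using int by (intro Liminf_mono always_eventually allI)
    also have "\<dots> = ennreal (C1 * B)" by (simp add: Liminf_const)
    finally have "wnorm u q (frac_max \<alpha> r s f g) \<le> enn_powr (ennreal (C1 * B)) (1 / q)"
      unfolding wnorm_def using q by (intro enn_powr_mono) auto
    also have "\<dots> = ennreal (C1 powr (1 / q) * (N1 powr (1 / p1) * N2 powr (1 / p2)))"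
      using C1 B q by (simp add: enn_powr_ennreal B_def powr_mult powr_powr)
    also have "\<dots> \<le> ennreal (C * (N1 powr (1 / p1) * N2 powr (1 / p2)))"
      by (intro ennreal_leI mult_right_mono) (auto simp: C_def)
    also have "\<dots> = ennreal C * wnorm v1 p1 (\<lambda>x. ennreal \<bar>f x\<bar>) * wnorm v2 p2 (\<lambda>x. ennreal \<bar>g x\<bar>)"
      unfolding N1(3) N2(3) by (simp add: C_def ennreal_mult' mult.assoc)
    finally show ?thesis .
  qed
  moreover have "0 < C" by (simp add: C_def add_nonneg_pos)
  ultimately show ?thesis by blast
qed


end
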